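(* Let $k\geq 4$ and $2\leq d\leq k-2$. Let $X_{k,d}^3$ consist of the two patterns $321$ and $(d+1,d+2,\dots,k-1,1,k,2,3,\dots,d)$, and let $x_{k,d}^3(n)$ be the number of permutations in $S_n$ avoiding both patterns. Then for all $n\geq k$, $$\sum_{j=0}^{k}(-1)^j\binom{k-j}{j}x_{k,d}^3(n-j)=0,$$ $x_{k,d}^3(n)=\frac{1}{n+1}\binom{2n}{n}$ for all $0\leq n\leq k-1$, and $$\sum_{n\geq0}x_{k,d}^3(n)x^n=\dfrac{U_{k-1}\left(\frac{1}{2\sqrt{x}}\right)}{\sqrt{x}\,U_k\left(\frac{1}{2\sqrt{x}}\right)}.$$
   Context: A permutation $\alpha\in S_n$ contains a pattern $\tau\in S_m$ if there are indices $i_1<\dots<i_m$ with $(\alpha_{i_1},\dots,\alpha_{i_m})$ order-isomorphic to $\tau$; otherwise it avoids $\tau$. $U_m$ is the Chebyshev polynomial of the second kind, $U_m(\cos\theta)=\sin((m+1)\theta)/\sin\theta$. *)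

theory Defs
  imports
    Complex_Main
    "HOL-Library.Sublist"
    "HOL-Combinatorics.Multiset_Permutations"
    "HOL-Computational_Algebra.Polynomial"
    "HOL-Computational_Algebra.Formal_Laurent_Series"
begin

text \<open>
  Permutations in \<open>S\<^sub>n\<close> and patterns are lists in one-line notation, so \<open>S\<^sub>n\<close> is
  \<^term>\<open>permutations_of_set {1..n}\<close>. A subsequence of \<open>\<alpha>\<close> at indices
  \<open>i\<^sub>1 < \<dots> < i\<^sub>m\<close> is a list \<open>\<sigma>\<close> with \<^term>\<open>subseq \<sigma> \<alpha>\<close>.
\<close>

definition order_isomorphic :: "nat list \<Rightarrow> nat list \<Rightarrow> bool" where
  "order_isomorphic \<sigma> \<tau> \<longleftrightarrow>
     length \<sigma> = length \<tau> \<and>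
     (\<forall>i<length \<tau>. \<forall>j<length \<tau>. \<sigma> ! i < \<sigma> ! j \<longleftrightarrow> \<tau> ! i < \<tau> ! j)"

definition contains_pattern :: "nat list \<Rightarrow> nat list \<Rightarrow> bool" where
  "contains_pattern \<alpha> \<tau> \<longleftrightarrow> (\<exists>\<sigma>. subseq \<sigma> \<alpha> \<and> order_isomorphic \<sigma> \<tau>)"

definition avoids_pattern :: "nat list \<Rightarrow> nat list \<Rightarrow> bool" where
  "avoids_pattern \<alpha> \<tau> \<longleftrightarrow> \<not> contains_pattern \<alpha> \<tau>"

definition X3 :: "nat \<Rightarrow> nat \<Rightarrow> nat list set" where
  "X3 k d = {[3, 2, 1], [d+1..<k] @ [1, k] @ [2..<d+1]}"

definition x3 :: "nat \<Rightarrow> nat \<Rightarrow> nat \<Rightarrow> nat" where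
  "x3 k d n = card {\<alpha> \<in> permutations_of_set {1..n}. \<forall>\<tau>\<in>X3 k d. avoids_pattern \<alpha> \<tau>}"

text \<open>
  The Chebyshev polynomial of the second kind is the polynomial characterised by
  \<open>U\<^sub>m(cos \<theta>) = sin ((m+1) \<theta>) / sin \<theta>\<close>; existence and uniqueness are proved below.
\<close>

definition cheb_U :: "nat \<Rightarrow> real poly" where
  "cheb_U m = (THE p. \<forall>\<theta>::real. sin \<theta> \<noteq> 0 \<longrightarrow>
     poly p (cos \<theta>) = sin (real (m + 1) * \<theta>) / sin \<theta>)"

text \<open>
  Evaluation of \<^term>\<open>cheb_U m\<close> in the field of formal Laurent series over the reals.
\<close>

definition cheb_U_fls :: "nat \<Rightarrow> real fls \<Rightarrow> real fls" where
  "cheb_U_fls m z = poly (map_poly fls_const (cheb_U m)) z"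

fun cheb_U_rec :: "nat \<Rightarrow> real poly" where
  "cheb_U_rec 0 = 1"
| "cheb_U_rec (Suc 0) = [:0, 2:]"
| "cheb_U_rec (Suc (Suc m)) = [:0, 2:] * cheb_U_rec (Suc m) - cheb_U_rec m"

lemma poly_cheb_U_rec: "poly (cheb_U_rec m) (cos \<theta>) * sin \<theta> = sin (real (m + 1) * \<theta>)"
proof (induction m rule: cheb_U_rec.induct)
  case 1
  show ?case by simp
next
  case 2
  show ?case by (simp add: sin_double)
next
  case (3 m)
  define a where "a = real (m + 2) * \<theta>"
  have "sin (a + \<theta>) + sin (a - \<theta>) = 2 * cos \<theta> * sin a"
    by (simp add: sin_add sin_diff)
  moreover have "real (Suc (Suc m) + 1) * \<theta> = a + \<theta>" "real (m + 1) * \<theta> = a - \<theta>"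
    "real (Suc m + 1) * \<theta> = a"
    by (simp_all add: a_def algebra_simps)
  ultimately have *: "sin (real (Suc (Suc m) + 1) * \<theta>) =
      2 * cos \<theta> * sin (real (Suc m + 1) * \<theta>) - sin (real (m + 1) * \<theta>)"
    by (metis add_diff_cancel_right')
  have "poly (cheb_U_rec (Suc (Suc m))) (cos \<theta>) * sin \<theta> =
      2 * cos \<theta> * (poly (cheb_U_rec (Suc m)) (cos \<theta>) * sin \<theta>) -
      poly (cheb_U_rec m) (cos \<theta>) * sin \<theta>"
    by (simp add: algebra_simps)
  then show ?case
    unfolding 3 * .
qed

lemma cheb_U_eq_rec: "cheb_U m = cheb_U_rec m"
  unfolding cheb_U_def
proof (rule the_equality)
  show "\<forall>\<theta>::real. sin \<theta> \<noteq> 0 \<longrightarrow>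
      poly (cheb_U_rec m) (cos \<theta>) = sin (real (m + 1) * \<theta>) / sin \<theta>"
    using poly_cheb_U_rec by (auto simp: field_simps)
next
  fix p :: "real poly"
  assume p: "\<forall>\<theta>. sin \<theta> \<noteq> 0 \<longrightarrow> poly p (cos \<theta>) = sin (real (m + 1) * \<theta>) / sin \<theta>"
  have "poly (p - cheb_U_rec m) y = 0" if y: "y \<in> {-1<..<1}" for y
  proof -
    have "cos (arccos y) = y" "sin (arccos y) \<noteq> 0"
      using y by (auto simp: sin_arccos_nonzero)
    moreover from this have "poly p (cos (arccos y)) * sin (arccos y) =
        poly (cheb_U_rec m) (cos (arccos y)) * sin (arccos y)"
      using p[rule_format, of "arccos y"] unfolding poly_cheb_U_rec by simp
    ultimately show ?thesis by simp
  qed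
  then have "{-1<..<1} \<subseteq> {y. poly (p - cheb_U_rec m) y = 0}"
    by blast
  moreover have "infinite {-1<..<1::real}"
    by (simp add: infinite_Ioo)
  ultimately have "infinite {y. poly (p - cheb_U_rec m) y = 0}"
    using finite_subset by blast
  then have "p - cheb_U_rec m = 0"
    using poly_roots_finite by blast
  then show "p = cheb_U_rec m" by simp
qed

lemma poly_cheb_U:
  "sin \<theta> \<noteq> 0 \<Longrightarrow> poly (cheb_U m) (cos \<theta>) = sin (real (m + 1) * \<theta>) / sin \<theta>"
  using poly_cheb_U_rec[of m \<theta>] by (auto simp: cheb_U_eq_rec field_simps)

text \<open>
  Let \<open>F\<close> be a formal power series in \<open>x\<close>. To read \<open>\<surd>x\<close> formally, we substitute
  \<open>x = t\<^sup>2\<close>, where \<open>t\<close> is the Laurent variable \<^term>\<open>fls_X\<close>; thus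
  \<^term>\<open>fls_X\<close> stands for \<open>\<surd>x\<close> and \<open>in_sqrt F\<close> is \<open>F\<close> as a Laurent series in \<open>\<surd>x\<close>.
\<close>

definition in_sqrt :: "real fps \<Rightarrow> real fls" where
  "in_sqrt F = fps_to_fls (fps_compose F (fps_X ^ 2))"

end

theory Submission
  imports Defs
begin

text \<open>
  A permutation avoiding both patterns is built by successively inserting its maximum. For
  \<open>321\<close>-avoiders the insertion sites lie in the maximal increasing suffix, and which of
  them create the second pattern depends only on the numbers of larger entries to the left of
  the suffix entries. Forgetting the first suffix entry turns this process for \<open>(k, d)\<close> into the
  one for \<open>(k - 1, d - 1)\<close> between two consecutive times at which the suffix shrinks to one
  entry. Hence the generating functions satisfy \<open>F\<^sub>k = 1 / (1 - x F\<^bsub>k-1\<^esub>)\<close>, which is the recurrence of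
  \<open>Q\<^bsub>k-1\<^esub> / Q\<^sub>k\<close> with \<open>Q\<^sub>k(x) = \<surd>x\<^sup>k U\<^sub>k(1 / (2\<surd>x))\<close>.
\<close>

section \<open>Chebyshev polynomials and Catalan numbers\<close>

text \<open>The reduction lowers \<open>k\<close> and \<open>d\<close> together and keeps
  \<open>e = k - d - 1\<close>. It rests on states being weakly decreasing. At the same site, the
  full state keeps exactly one more entry than its tail, namely the oldest survivor; if anything
  kept by the tail has reached \<open>e\<close>, that extra entry has too, so the bound
  \<open>d - 1\<close> moves by exactly one. If nothing kept by the tail has reached
  \<open>e\<close>, the extra entry alone does no harm once \<open>d \<ge> 3\<close>. For the same
  reason the step that keeps a single entry is always open, so the returns cut the process into
  independent pieces.

  For \<open>d = 2\<close> one old survivor already closes a site \<open>t > 0\<close>, and the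
  reduction breaks down; this is why a symmetry and a separate base case enter. Each first-return
  decomposition adds one level to the finite continued fraction 1/(1 - x/(1 - x/...)), whose
  infinite form is the Catalan series. This explains both the Catalan initial values and why the
  result depends on \<open>k\<close> but not on \<open>d\<close>.\<close>

fun cheb_Q :: "nat \<Rightarrow> real fps" where
  "cheb_Q 0 = 1"
| "cheb_Q (Suc 0) = 1"
| "cheb_Q (Suc (Suc k)) = cheb_Q (Suc k) - fps_X * cheb_Q k"

lemma cheb_Q_nth: "cheb_Q k $ j = (-1) ^ j * real ((k - j) choose j)"
proof (induction k arbitrary: j rule: cheb_Q.induct)
  case 1
  show ?case by (cases j) auto
next
  case 2
  show ?case by (cases j) auto
next
  case (3 k)
  show ?case
  proof (cases j)
    case (Suc i)
    show ?thesis
    proof (cases "i \<le> k")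
      case True
      then have "Suc (Suc k) - j = Suc (k - i)" "Suc k - j = k - i" by (simp_all add: Suc)
      then show ?thesis using 3 by (simp add: Suc algebra_simps)
    next
      case False
      then show ?thesis using 3 by (simp add: Suc binomial_eq_0)
    qed
  qed (use 3 in simp)
qed

lemma cheb_Q_neq_0: "cheb_Q k \<noteq> 0"
proof
  assume "cheb_Q k = 0"
  then have "cheb_Q k $ 0 = 0" by simp
  then show False by (simp add: cheb_Q_nth)
qed

definition catalan :: "nat \<Rightarrow> real" where
  "catalan n = 1 / real (n + 1) * real ((2 * n) choose n)"

text \<open>The right-hand side is the coefficient of x^n in (1 - sqrt(1 - 4x)) / (2x), by Newton's
  binomial series. The induction compares ratios of consecutive terms.\<close>

lemma catalan_eq_gbinomial: "catalan n = - (1 / 2) * (-4) ^ Suc n * ((1 / 2) gchoose Suc n)"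
proof (induction n)
  case 0
  show ?case by (simp add: catalan_def)
next
  case (Suc n)
  have g: "((1 / 2 :: real) gchoose Suc (Suc n)) * real (n + 2) = ((1 / 2) gchoose Suc n) * (1 / 2 - real (Suc n))"
    using gbinomial_absorb_comp[of "1/2::real" "Suc n"] gbinomial_absorption[of "Suc n" "1/2::real"]
    by (simp add: algebra_simps)
  have c: "catalan (Suc n) * real (n + 2) = catalan n * real (4 * n + 2)"
  proof -
    have cat: "catalan m = fact (2 * m) / (fact m * fact (Suc m))" for m
      by (simp add: catalan_def binomial_fact mult.commute)
    have "fact (2 * Suc n) = (2 * real n + 2) * (2 * real n + 1) * fact (2 * n)"
      by (simp add: algebra_simps)
    then show ?thesis
      unfolding cat by (simp add: divide_simps del: mult_Suc_right) (simp add: algebra_simps)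
  qed
  have "catalan (Suc n) * real (n + 2) = - (1 / 2) * (-4) ^ Suc n * (((1 / 2) gchoose Suc n) * (1 / 2 - real (Suc n))) * (-4)"
    unfolding c Suc by (simp add: algebra_simps)
  also have "\<dots> = (- (1 / 2) * (-4) ^ Suc (Suc n) * ((1 / 2) gchoose Suc (Suc n))) * real (n + 2)"
    unfolding g[symmetric] by (simp add: algebra_simps)
  finally show ?case
    using mult_right_cancel[of "real (n + 2)"] by (metis of_nat_eq_0_iff add_is_0 zero_neq_numeral)
qed

text \<open>Coefficient form of sqrt(1 - 4x)^2 = 1 - 4x: Vandermonde for 1/2 + 1/2 = 1 gives zero in
  degree n + 2; its two equal end terms yield the left-hand side, its inner terms the
  convolution.\<close>

lemma catalan_Suc: "catalan (Suc n) = (\<Sum>i\<le>n. catalan i * catalan (n - i))"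
proof -
  define g where "g = (\<lambda>i. (1 / 2 :: real) gchoose i)"
  have "(\<Sum>i\<le>Suc (Suc n). g i * g (Suc (Suc n) - i)) = (1 gchoose Suc (Suc n))"
    using gbinomial_Vandermonde[of "1/2::real" "1/2" "Suc (Suc n)"] by (simp add: g_def atLeast0AtMost)
  also have "\<dots> = 0"
    using gbinomial_of_nat_symmetric by (metis binomial_1 binomial_eq_0_iff binomial_gbinomial less_Suc_eq_0_disj of_nat_0 of_nat_1 one_less_numeral_iff Suc_less_eq zero_less_Suc One_nat_def)
  finally have "2 * g 0 * g (Suc (Suc n)) + (\<Sum>i\<le>n. g (Suc i) * g (Suc n - i)) = 0"
    by (subst (asm) sum.atMost_Suc, subst (asm) sum.atMost_Suc_shift) simp
  then have "(\<Sum>i\<le>n. g (Suc i) * g (Suc n - i)) = - 2 * g (Suc (Suc n))"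
    by (simp add: g_def)
  moreover have "catalan i * catalan (n - i) = 4 * (-4) ^ n * (g (Suc i) * g (Suc n - i))" if "i \<le> n" for i
  proof -
    have "(-4::real) ^ n = (-4) ^ i * (-4) ^ (n - i)" using that by (simp flip: power_add)
    then show ?thesis
      using that by (simp add: catalan_eq_gbinomial g_def Suc_diff_le)
  qed
  ultimately have "(\<Sum>i\<le>n. catalan i * catalan (n - i)) = 4 * (-4) ^ n * (- 2 * g (Suc (Suc n)))"
    by (simp flip: sum_distrib_left)
  then show ?thesis by (simp add: catalan_eq_gbinomial g_def)
qed

text \<open>Consecutive quotients satisfy F = 1 + x G F, while the Catalan series C satisfies C = 1
  + x C C. The factor x carries agreement of G up to degree k to agreement of F up to degree k +
  1.\<close>

lemma cheb_Q_quotient_nth: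
  assumes "cheb_Q (Suc k) * F = cheb_Q k" and "n \<le> k"
  shows "F $ n = catalan n"
  using assms
proof (induction k arbitrary: n F)
  case 0
  then show ?case by (simp add: catalan_def)
next
  case (Suc k)
  define G where "G = cheb_Q k / cheb_Q (Suc k)"
  have unit: "is_unit (cheb_Q (Suc k))" by (simp add: fps_is_unit_iff cheb_Q_nth)
  have G: "cheb_Q (Suc k) * G = cheb_Q k" using unit by (simp add: G_def)
  have "cheb_Q (Suc k) * (F - fps_X * (G * F)) = cheb_Q (Suc (Suc k)) * F"
    by (simp add: algebra_simps flip: G)
  also have "\<dots> = cheb_Q (Suc k) * 1" using Suc.prems by simp
  finally have "F - fps_X * (G * F) = 1"
    using cheb_Q_neq_0 mult_left_cancel by blast
  then have F: "F = 1 + fps_X * (G * F)" by (simp add: algebra_simps)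
  show ?case using Suc.prems(2)
  proof (induction n rule: less_induct)
    case (less n)
    show ?case
    proof (cases n)
      case 0
      then show ?thesis by (subst F) (simp add: catalan_def)
    next
      case (Suc m)
      have "F $ n = (\<Sum>i\<le>m. G $ i * F $ (m - i))"
        by (subst F) (simp add: Suc, simp add: fps_mult_nth atLeast0AtMost)
      also have "\<dots> = (\<Sum>i\<le>m. catalan i * catalan (m - i))"
        using less Suc by (intro sum.cong refl arg_cong2[where f="(*)"] Suc.IH[OF G]) auto
      finally show ?thesis by (simp add: Suc catalan_Suc)
    qed
  qed
qed

text \<open>The series \<open>cheb_Q (k - 1)\<close> has no term of degree n \<ge> k. For j > k the
  truncated \<open>k - j\<close> turns the binomial into \<open>0 choose j\<close>, so the
  convolution may be cut at k.\<close>

lemma recurrence_of_cheb_Q: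
  assumes "cheb_Q k * Abs_fps (\<lambda>n. real (f n)) = cheb_Q (k - 1)" and "1 \<le> k" and "k \<le> n"
  shows "(\<Sum>j=0..k. (-1) ^ j * int ((k - j) choose j) * int (f (n - j))) = 0"
proof -
  have "real_of_int (\<Sum>j=0..k. (-1) ^ j * int ((k - j) choose j) * int (f (n - j))) =
      (\<Sum>j=0..k. cheb_Q k $ j * real (f (n - j)))"
    by (simp add: cheb_Q_nth)
  also have "\<dots> = (\<Sum>j=0..n. cheb_Q k $ j * real (f (n - j)))"
    using assms(2,3) by (intro sum.mono_neutral_left) (auto simp: cheb_Q_nth binomial_eq_0)
  also have "\<dots> = (cheb_Q k * Abs_fps (\<lambda>n. real (f n))) $ n"
    by (simp add: fps_mult_nth)
  also have "\<dots> = 0"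
    using assms(2,3) unfolding assms(1) by (simp add: cheb_Q_nth binomial_eq_0)
  finally show ?thesis by linarith
qed

section \<open>Evaluating Chebyshev polynomials at 1/(2t) with t = sqrt x\<close>

lemma poly_map_fls_const_add:
  "poly (map_poly fls_const (p + q)) z = poly (map_poly fls_const p) z + poly (map_poly fls_const q) z"
  by (induction p q rule: poly_induct2) (simp_all add: map_poly_pCons algebra_simps flip: fls_plus_const)

lemma poly_map_fls_const_smult:
  "poly (map_poly fls_const (smult c p)) z = fls_const c * poly (map_poly fls_const p) z"
  by (induction p) (simp_all add: map_poly_pCons algebra_simps)

lemma cheb_U_fls_rec:
  "cheb_U_fls (Suc (Suc m)) z = 2 * z * cheb_U_fls (Suc m) z - cheb_U_fls m z"
proof -
  have "cheb_U (Suc (Suc m)) = smult 2 (pCons 0 (cheb_U (Suc m))) + smult (-1) (cheb_U m)"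
    by (simp add: cheb_U_eq_rec)
  then show ?thesis
    unfolding cheb_U_fls_def
    by (simp only: poly_map_fls_const_add poly_map_fls_const_smult) 
       (simp add: map_poly_pCons algebra_simps flip: fls_const_numeral)
qed

text \<open>Multiplying the three-term recurrence at z = 1/(2t) by t^(m+2) turns 2 z t into 1 and
  leaves t^2 = x at the older term: this is the recurrence of \<open>cheb_Q\<close>.\<close>

lemma cheb_U_fls_eq_Q:
  "fls_X ^ m * cheb_U_fls m (1 / (2 * fls_X)) = in_sqrt (cheb_Q m)"
proof (induction m rule: cheb_Q.induct)
  case 1
  show ?case by (simp add: cheb_U_fls_def cheb_U_eq_rec in_sqrt_def)
next
  case 2
  have "cheb_U_fls (Suc 0) (1 / (2 * fls_X)) = 1 / fls_X"
    by (simp add: cheb_U_fls_def cheb_U_eq_rec map_poly_pCons del: fls_const_numeral add: fls_const_numeral)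
  moreover have "fls_X ^ 1 * (1 / fls_X) = (1 :: real fls)"
    using nonzero_mult_div_cancel_left[of "fls_X :: real fls" 1] by (simp del: fls_divide_X)
  ultimately show ?case by (simp add: in_sqrt_def del: fls_divide_X)
next
  case (3 m)
  let ?u = "\<lambda>m. cheb_U_fls m (1 / (2 * fls_X))"
  have X: "fls_X * (1 / fls_X) = (1 :: real fls)"
    using nonzero_mult_div_cancel_left[of "fls_X :: real fls" 1] by (simp del: fls_divide_X)
  have two: "(2 :: real fls) * (1 / (2 * fls_X)) = 1 / fls_X" by simp
  have "fls_X ^ Suc (Suc m) * ?u (Suc (Suc m)) =
      fls_X ^ Suc m * ?u (Suc m) - fls_X ^ 2 * (fls_X ^ m * ?u m)"
    unfolding cheb_U_fls_rec two
    by (simp add: right_diff_distrib X mult.assoc[of _ fls_X] power2_eq_square del: fls_divide_X)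
  also have "\<dots> = in_sqrt (cheb_Q (Suc (Suc m)))"
    unfolding 3 by (simp add: in_sqrt_def fps_compose_sub_distrib fps_compose_mult_distrib
        fls_times_fps_to_fls fps_to_fls_power)
  finally show ?case .
qed

lemma in_sqrt_mult: "in_sqrt (F * G) = in_sqrt F * in_sqrt G"
  by (simp add: in_sqrt_def fps_compose_mult_distrib fls_times_fps_to_fls)

lemma in_sqrt_neq_0: "F \<noteq> 0 \<Longrightarrow> in_sqrt F \<noteq> 0"
  by (simp add: in_sqrt_def fps_compose_eq_0_iff)

lemma in_sqrt_quotient:
  assumes "cheb_Q k * F = cheb_Q (k - 1)" and "1 \<le> k"
  shows "in_sqrt F = cheb_U_fls (k - 1) (1 / (2 * fls_X)) / (fls_X * cheb_U_fls k (1 / (2 * fls_X)))"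
proof -
  let ?u = "\<lambda>m. cheb_U_fls m (1 / (2 * fls_X))"
  have "in_sqrt (cheb_Q k) \<noteq> 0" by (simp add: in_sqrt_neq_0 cheb_Q_neq_0)
  moreover have "in_sqrt (cheb_Q k) * in_sqrt F = in_sqrt (cheb_Q (k - 1))"
    by (simp add: assms(1) flip: in_sqrt_mult)
  ultimately have "in_sqrt F = (fls_X ^ (k - 1) * ?u (k - 1)) / (fls_X ^ k * ?u k)"
    unfolding cheb_U_fls_eq_Q by (simp add: field_simps)
  also have "fls_X ^ k = (fls_X ^ (k - 1) * fls_X :: real fls)"
    using assms(2) by (cases k) simp_all
  finally show ?thesis by (simp add: mult.assoc)
qed

section \<open>The insertion process\<close>

text \<open>
  The state of a permutation lists, for each entry of its maximal increasing suffix, the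
  number of larger entries before it. Inserting a new maximum before the \<open>t\<close>-th entry
  of the suffix drops the first \<open>t\<close> entries of the state and increments the others;
  inserting it at the end appends a \<open>0\<close>. The site \<open>t\<close> is admissible if no forbidden
  pattern arises, where \<open>e = k - d - 1\<close>.
\<close>

definition admissible_site :: "nat \<Rightarrow> nat \<Rightarrow> nat list \<Rightarrow> nat \<Rightarrow> bool" where
  "admissible_site d e S t \<longleftrightarrow> t = 0 \<or> length (filter (\<lambda>c. e \<le> c) (drop t S)) < d - 1"

text \<open>The separate summand is insertion at the end. It needs no test when
  \<open>2 \<le> d\<close>, as nothing remains behind the new maximum.\<close>

fun num_ext :: "nat \<Rightarrow> nat \<Rightarrow> nat \<Rightarrow> nat list \<Rightarrow> nat" where
  "num_ext d e 0 S = 1"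
| "num_ext d e (Suc n) S = num_ext d e n (S @ [0]) +
     (\<Sum>t<length S. if admissible_site d e S t then num_ext d e n (map Suc (drop t S)) else 0)"

lemma admissible_site_tl:
  assumes "3 \<le> d" "sorted_wrt (\<ge>) (a # R)" "t < length R"
  shows "admissible_site d e (a # R) t \<longleftrightarrow> admissible_site (d - 1) e R t"
proof (cases t)
  case (Suc s)
  let ?old = "\<lambda>xs. length (filter (\<lambda>c. e \<le> c) xs)"
  have "drop s R = R ! s # drop t R"
    using assms(3) Suc by (simp add: Cons_nth_drop_Suc)
  moreover have "sorted_wrt (\<ge>) (drop s R)"
    using assms(2) by (simp add: sorted_wrt_drop)
  \<comment> \<open>By monotonicity \<open>R ! s\<close> is old as soon as a later entry is. If no
    later entry is old, both inequalities below hold because \<open>3 \<le> d\<close>.\<close>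
  ultimately have *: "?old (drop s R) = (if ?old (drop t R) = 0 then ?old [R ! s] else Suc (?old (drop t R)))"
    by (auto simp: filter_empty_conv not_le intro: order_trans)
  then have "?old (drop s R) < d - 1 \<longleftrightarrow> ?old (drop t R) < d - 1 - 1"
    using assms(1) by (auto split: if_splits)
  then show ?thesis
    by (simp add: admissible_site_def Suc)
qed (simp add: admissible_site_def)

text \<open>
  Ignoring the oldest entry of the state turns the \<open>d\<close>-process into the
  \<open>(d-1)\<close>-process, until a step keeps that entry only; from then on the process is
  that of a singleton state, whose entry does not influence the count.
\<close>

lemma num_ext_first_return:
  assumes "3 \<le> d" "sorted_wrt (\<ge>) S" "S \<noteq> []"
  shows "num_ext d e n S = num_ext (d - 1) e n (tl S) +
    (\<Sum>i<n. num_ext (d - 1) e i (tl S) * num_ext d e (n - 1 - i) [0])"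
  using assms(2,3)
proof (induction n arbitrary: S)
  case 0
  then show ?case by simp
next
  case (Suc n)
  obtain a R where S: "S = a # R" using Suc.prems(2) by (cases S) auto
  let ?m = "length R"
  \<comment> \<open>The contribution of the runs that do return to a singleton, as a function of the
    tail.\<close>
  define K where "K = (\<lambda>X. \<Sum>i<n. num_ext (d - 1) e i X * num_ext d e (n - 1 - i) [0])"
  have IH: "num_ext d e n X = num_ext (d - 1) e n (tl X) + K (tl X)"
    if "sorted_wrt (\<ge>) X" "X \<noteq> []" for X
    using Suc.IH[OF that] by (simp add: K_def)
  have dec: "sorted_wrt (\<ge>) (map Suc (drop t S))" for t
    using sorted_wrt_drop[OF Suc.prems(1), of t] by (simp add: sorted_wrt_map)
  have end1: "num_ext d e n (S @ [0]) = num_ext (d - 1) e n (R @ [0]) + K (R @ [0])"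
    using Suc.prems(1) S by (subst IH) (auto simp: sorted_wrt_append)
  have single: "num_ext d e n [c] = num_ext d e n [0]" for c
    using IH[of "[c]"] IH[of "[0]"] by simp
  have last: "num_ext d e n (map Suc (drop ?m S)) = num_ext d e n [0]"
  proof -
    obtain c where "drop ?m S = [c]"
      by (cases R rule: rev_cases) (auto simp: S)
    then show ?thesis using single[of "Suc c"] by simp
  qed
  \<comment> \<open>A single survivor stays below the bound \<open>d - 1\<close>, so the return step
    is always available.\<close>
  have adm_last: "admissible_site d e S ?m"
  proof -
    have "length (filter (\<lambda>c. e \<le> c) (drop ?m S)) \<le> length (drop ?m S)"
      by (rule length_filter_le)
    also have "\<dots> = 1" by (simp add: S)
    finally show ?thesis using assms(1) unfolding admissible_site_def by linarith
  qed
  have mid: "(if admissible_site d e S t then num_ext d e n (map Suc (drop t S)) else 0) =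
     (if admissible_site (d - 1) e R t then num_ext (d - 1) e n (map Suc (drop t R)) + K (map Suc (drop t R)) else 0)"
    if "t < ?m" for t
  proof -
    have "tl (map Suc (drop t S)) = map Suc (drop t R)"
      by (simp add: S drop_Suc_Cons tl_drop flip: map_tl)
    then show ?thesis
      using that IH[OF dec[of t]] admissible_site_tl[OF assms(1), of a R t e] Suc.prems(1)
      by (simp add: S)
  qed
  have step: "num_ext (d - 1) e (Suc i) R = num_ext (d - 1) e i (R @ [0]) +
     (\<Sum>t<?m. if admissible_site (d - 1) e R t then num_ext (d - 1) e i (map Suc (drop t R)) else 0)" for i
    by (rule num_ext.simps)
  have "(\<Sum>i<n. num_ext (d - 1) e (Suc i) R * num_ext d e (n - 1 - i) [0]) =
     K (R @ [0]) + (\<Sum>t<?m. if admissible_site (d - 1) e R t then K (map Suc (drop t R)) else 0)"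
  proof -
    have "(\<Sum>i<n. (\<Sum>t<?m. if admissible_site (d - 1) e R t then num_ext (d - 1) e i (map Suc (drop t R)) else 0)
            * num_ext d e (n - 1 - i) [0]) =
          (\<Sum>t<?m. if admissible_site (d - 1) e R t then K (map Suc (drop t R)) else 0)"
      unfolding sum_distrib_right
      by (subst sum.swap) (auto simp: K_def intro!: sum.cong)
    then show ?thesis
      unfolding step add_mult_distrib sum.distrib by (simp add: K_def)
  qed
  \<comment> \<open>The term for \<open>i = 0\<close> is a return at the very first step; all other
    returns move one step later.\<close>
  moreover have "(\<Sum>i<Suc n. num_ext (d - 1) e i R * num_ext d e (n - i) [0]) =
     num_ext d e n [0] + (\<Sum>i<n. num_ext (d - 1) e (Suc i) R * num_ext d e (n - 1 - i) [0])"
    by (subst sum.lessThan_Suc_shift) simp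
  moreover have "num_ext d e (Suc n) S = num_ext d e n (S @ [0]) +
     ((\<Sum>t<?m. if admissible_site (d - 1) e R t then num_ext (d - 1) e n (map Suc (drop t R)) + K (map Suc (drop t R)) else 0)
      + num_ext d e n [0])"
  proof -
    have "{..<length S} = insert ?m {..<?m}" by (auto simp: S)
    moreover have "(\<Sum>t<?m. if admissible_site d e S t then num_ext d e n (map Suc (drop t S)) else 0) =
      (\<Sum>t<?m. if admissible_site (d - 1) e R t then num_ext (d - 1) e n (map Suc (drop t R)) + K (map Suc (drop t R)) else 0)"
      using mid by (intro sum.cong) auto
    ultimately show ?thesis
      unfolding num_ext.simps using adm_last last by simp
  qed
  moreover have "(\<Sum>t<?m. if admissible_site (d - 1) e R t then num_ext (d - 1) e n (map Suc (drop t R)) + K (map Suc (drop t R)) else 0)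
    = (\<Sum>t<?m. if admissible_site (d - 1) e R t then num_ext (d - 1) e n (map Suc (drop t R)) else 0)
     + (\<Sum>t<?m. if admissible_site (d - 1) e R t then K (map Suc (drop t R)) else 0)"
    by (subst sum.distrib[symmetric], rule sum.cong) auto
  ultimately show ?case
    using end1 step[of n] by (simp only: S list.sel diff_Suc_1)
qed

definition ext_fps :: "nat \<Rightarrow> nat \<Rightarrow> real fps" where
  "ext_fps d e = Abs_fps (\<lambda>n. real (num_ext d e n []))"

text \<open>The first insertion leads to \<open>[0]\<close>, whose tail is empty. With G the series
  for \<open>d - 1\<close> and f the series from \<open>[0]\<close>, this gives F = 1 + x f and f =
  G + x G f; eliminating f yields the claim.\<close>

lemma ext_fps_step:
  assumes "3 \<le> d"
  shows "ext_fps d e * (1 - fps_X * ext_fps (d - 1) e) = 1"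
proof -
  define f where "f = Abs_fps (\<lambda>n. real (num_ext d e n [0]))"
  have F: "ext_fps d e = 1 + fps_X * f"
  proof (rule fps_ext)
    fix n show "ext_fps d e $ n = (1 + fps_X * f) $ n"
      by (cases n) (simp_all add: ext_fps_def f_def)
  qed
  have f: "f = ext_fps (d - 1) e + fps_X * (ext_fps (d - 1) e * f)"
  proof (rule fps_ext)
    fix n
    have "(fps_X * (ext_fps (d - 1) e * f)) $ n =
        real (\<Sum>i<n. num_ext (d - 1) e i [] * num_ext d e (n - 1 - i) [0])"
    proof (cases n)
      case (Suc m)
      have "(ext_fps (d - 1) e * f) $ m = (\<Sum>i\<le>m. real (num_ext (d - 1) e i []) * real (num_ext d e (m - i) [0]))"
        by (simp add: fps_mult_nth ext_fps_def f_def atLeast0AtMost)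
      then show ?thesis
        by (simp add: Suc lessThan_Suc_atMost)
    qed simp
    moreover have "f $ n = real (num_ext (d - 1) e n []) + real (\<Sum>i<n. num_ext (d - 1) e i [] * num_ext d e (n - 1 - i) [0])"
      using num_ext_first_return[OF assms, of "[0]" e n] by (simp add: f_def)
    ultimately show "f $ n = (ext_fps (d - 1) e + fps_X * (ext_fps (d - 1) e * f)) $ n"
      by (simp add: ext_fps_def)
  qed
  have "ext_fps d e * (1 - fps_X * ext_fps (d - 1) e) =
     1 - fps_X * ext_fps (d - 1) e + fps_X * (f - fps_X * (ext_fps (d - 1) e * f))"
    unfolding F by (simp add: algebra_simps)
  also have "f - fps_X * (ext_fps (d - 1) e * f) = ext_fps (d - 1) e"
    by (metis f add_diff_cancel_right')
  finally show ?thesis by simp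
qed

section \<open>Base case: avoiding 321 and 3142\<close>

fun empty_count single_count slope :: "nat \<Rightarrow> nat" where
  "empty_count 0 = 1"
| "empty_count (Suc n) = empty_count n + slope n"
| "single_count 0 = 1"
| "single_count (Suc n) = 2 * single_count n + slope n"
| "slope 0 = 0"
| "slope (Suc n) = slope n + single_count n"

text \<open>Here a site \<open>t > 0\<close> is open only if no positive count survives, and every
  insertion except at the end makes all surviving counts positive. So only the presence of a
  positive count and the number \<open>f\<close> of zeros matter, the latter linearly.\<close>

lemma num_ext_2_1:
  assumes "\<forall>c\<in>set os. 1 \<le> c"
  shows "num_ext 2 1 n (os @ replicate f 0) =
    (if os = [] then empty_count n else single_count n) + f * slope n"
  using assms
proof (induction n arbitrary: os f)
  case (Suc n)
  let ?S = "os @ replicate f 0" and ?o = "length os"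
  have A: "num_ext 2 1 n (?S @ [0]) = (if os = [] then empty_count n else single_count n) + Suc f * slope n"
    using Suc.IH[OF Suc.prems, of "Suc f"] by (simp add: replicate_append_same)
  \<comment> \<open>After \<open>map Suc\<close> no zero is left: the induction hypothesis applies
    with \<open>f = 0\<close> and a nonempty first part.\<close>
  have D: "num_ext 2 1 n (map Suc (drop t ?S)) = single_count n" if "t < length ?S" for t
  proof -
    have "drop t ?S \<noteq> []" using that by (simp only: drop_eq_Nil not_le)
    then show ?thesis using Suc.IH[of "map Suc (drop t ?S)" 0] by (simp del: drop_append)
  qed
  have adm: "admissible_site 2 1 ?S t \<longleftrightarrow> t = 0 \<or> ?o \<le> t" for t
  proof (cases "?o \<le> t")
    case False
    then have "drop t os \<noteq> []" by simp
    then obtain x where "x \<in> set (drop t os)" by (meson list.set_sel(1))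
    moreover from this have "1 \<le> x" using Suc.prems in_set_dropD by fastforce
    ultimately have "filter (\<lambda>c. 1 \<le> c) (drop t ?S) \<noteq> []"
      by (auto simp: filter_empty_conv)
    then show ?thesis using False by (auto simp: admissible_site_def)
  qed (simp add: admissible_site_def)
  have "(\<Sum>t<length ?S. if admissible_site 2 1 ?S t then num_ext 2 1 n (map Suc (drop t ?S)) else 0)
     = (\<Sum>t<?o + f. if t = 0 \<or> ?o \<le> t then single_count n else 0)"
    unfolding adm by (rule sum.cong) (use D in auto)
  also have "\<dots> = card {t \<in> {..<?o + f}. t = 0 \<or> ?o \<le> t} * single_count n"
    by (simp add: sum.If_cases Int_def)
  \<comment> \<open>Site 0 is an extra one only when \<open>os\<close> is nonempty.\<close>
  also have "{t \<in> {..<?o + f}. t = 0 \<or> ?o \<le> t} = (if os = [] then {} else {0}) \<union> {?o..<?o + f}"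
    by auto
  also have "card \<dots> = (if os = [] then f else Suc f)"
    by auto
  finally show ?case
    unfolding num_ext.simps A by (simp add: algebra_simps)
qed simp

text \<open>The three recurrences form a linear system over power series. Eliminating
  \<open>Y\<close> gives \<open>cheb_Q 4 * C = fps_X\<close>; then the factor 1 - x cancels and
  leaves Z = (1 - 2x)/(1 - 3x + x^2).\<close>

lemma cheb_Q_ext_fps_2_1: "cheb_Q 4 * ext_fps 2 1 = cheb_Q 3"
proof -
  define Z Y C where "Z = Abs_fps (\<lambda>n. real (empty_count n))"
    and "Y = Abs_fps (\<lambda>n. real (single_count n))" and "C = Abs_fps (\<lambda>n. real (slope n))"
  have Z: "ext_fps 2 1 = Z"
    using num_ext_2_1[of "[]" _ 0] by (simp add: ext_fps_def Z_def)
  have z: "Z = 1 + fps_X * (Z + C)"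
  proof (rule fps_ext)
    fix n show "Z $ n = (1 + fps_X * (Z + C)) $ n"
      by (cases n) (simp_all add: Z_def C_def)
  qed
  have y: "Y = 1 + fps_X * (fps_const 2 * Y + C)"
  proof (rule fps_ext)
    fix n show "Y $ n = (1 + fps_X * (fps_const 2 * Y + C)) $ n"
      by (cases n) (simp_all add: Y_def C_def)
  qed
  have c: "C = fps_X * (C + Y)"
  proof (rule fps_ext)
    fix n show "C $ n = (fps_X * (C + Y)) $ n"
      by (cases n) (simp_all add: Y_def C_def)
  qed
  have Q: "cheb_Q 3 = 1 - 2 * fps_X" "cheb_Q 4 = 1 - 3 * fps_X + fps_X ^ 2"
    by (simp_all add: eval_nat_numeral algebra_simps)
  have z': "(1 - fps_X) * Z = 1 + fps_X * C"
    using arg_cong[OF z, of "\<lambda>t. t - fps_X * Z"] by (simp add: algebra_simps numeral_fps_const)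
  have y': "(1 - 2 * fps_X) * Y = 1 + fps_X * C"
    using arg_cong[OF y, of "\<lambda>t. t - fps_const 2 * fps_X * Y"] by (simp add: algebra_simps numeral_fps_const)
  have c': "(1 - fps_X) * C = fps_X * Y"
    using arg_cong[OF c, of "\<lambda>t. t - fps_X * C"] by (simp add: algebra_simps numeral_fps_const)
  have "cheb_Q 4 * C = (1 - 2 * fps_X) * ((1 - fps_X) * C) - fps_X ^ 2 * C"
    unfolding Q by (simp add: algebra_simps power2_eq_square)
  also have "\<dots> = fps_X * ((1 - 2 * fps_X) * Y) - fps_X ^ 2 * C"
    unfolding c' by (simp add: algebra_simps)
  also have "\<dots> = fps_X"
    unfolding y' by (simp add: algebra_simps power2_eq_square)
  finally have QC: "cheb_Q 4 * C = fps_X" .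
  have "(1 - fps_X) * (cheb_Q 4 * Z) = cheb_Q 4 + fps_X * (cheb_Q 4 * C)"
    using arg_cong[OF z', of "\<lambda>t. cheb_Q 4 * t"] by (simp add: distrib_left mult.left_commute)
  also have "\<dots> = (1 - fps_X) * cheb_Q 3"
    by (simp only: QC) (simp add: Q algebra_simps power2_eq_square)
  finally have "(1 - fps_X) * (cheb_Q 4 * Z) = (1 - fps_X) * cheb_Q 3" .
  moreover have "(1 - fps_X :: real fps) \<noteq> 0"
    by (metis fps_X_neq_one eq_iff_diff_eq_0)
  ultimately show ?thesis unfolding Z by simp
qed

lemma cheb_Q_step:
  assumes "cheb_Q (Suc j) * G = cheb_Q j" and "F * (1 - fps_X * G) = 1"
  shows "cheb_Q (Suc (Suc j)) * F = cheb_Q (Suc j)"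
proof -
  have "cheb_Q (Suc (Suc j)) * F = cheb_Q (Suc j) * (F * (1 - fps_X * G))"
    by (simp add: algebra_simps flip: assms(1))
  then show ?thesis by (simp add: assms(2))
qed

lemma cheb_Q_ext_fps_shift:
  assumes "cheb_Q (Suc j) * ext_fps 2 e = cheb_Q j"
  shows "cheb_Q (Suc (j + i)) * ext_fps (i + 2) e = cheb_Q (j + i)"
proof (induction i)
  case (Suc i)
  have "ext_fps (Suc i + 2) e * (1 - fps_X * ext_fps (i + 2) e) = 1"
    using ext_fps_step[of "Suc i + 2" e] by simp
  from cheb_Q_step[OF Suc this] show ?case by simp
qed (use assms in \<open>simp add: numeral_2_eq_2\<close>)

section \<open>Insertion of a new maximum\<close>

lemma order_isomorphic_iff_map:
  "order_isomorphic \<sigma> \<tau> \<longleftrightarrow> (\<exists>f. strict_mono_on (set \<tau>) f \<and> \<sigma> = map f \<tau>)"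
proof
  assume "\<exists>f. strict_mono_on (set \<tau>) f \<and> \<sigma> = map f \<tau>"
  then show "order_isomorphic \<sigma> \<tau>"
    by (auto simp: order_isomorphic_def strict_mono_on_less)
next
  assume iso: "order_isomorphic \<sigma> \<tau>"
  \<comment> \<open>Any position of the letter may be chosen: order isomorphism forces equal entries
    of \<open>\<sigma>\<close> at equal letters of \<open>\<tau>\<close>.\<close>
  define f where "f v = \<sigma> ! (SOME i. i < length \<tau> \<and> \<tau> ! i = v)" for v
  have f: "f (\<tau> ! i) = \<sigma> ! i" if "i < length \<tau>" for i
  proof -
    let ?j = "SOME j. j < length \<tau> \<and> \<tau> ! j = \<tau> ! i"
    have "?j < length \<tau> \<and> \<tau> ! ?j = \<tau> ! i"
      by (rule someI[of _ i]) (use that in simp)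
    with iso that have "\<not> \<sigma> ! ?j < \<sigma> ! i" "\<not> \<sigma> ! i < \<sigma> ! ?j"
      unfolding order_isomorphic_def by fastforce+
    then show ?thesis by (simp add: f_def)
  qed
  have "strict_mono_on (set \<tau>) f"
    using iso f by (intro strict_mono_onI) (auto simp: order_isomorphic_def in_set_conv_nth)
  moreover have "\<sigma> = map f \<tau>"
    using iso f by (intro nth_equalityI) (auto simp: order_isomorphic_def)
  ultimately show "\<exists>f. strict_mono_on (set \<tau>) f \<and> \<sigma> = map f \<tau>" by blast
qed

lemma contains_pattern_iff_map:
  "contains_pattern \<alpha> \<tau> \<longleftrightarrow> (\<exists>f. strict_mono_on (set \<tau>) f \<and> subseq (map f \<tau>) \<alpha>)"
  by (auto simp: contains_pattern_def order_isomorphic_iff_map)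

lemma contains_321_iff:
  "contains_pattern \<alpha> [3, 2, 1] \<longleftrightarrow> (\<exists>a b c. b < a \<and> c < b \<and> subseq [a, b, c] \<alpha>)"
proof
  assume "contains_pattern \<alpha> [3, 2, 1]"
  then obtain f :: "nat \<Rightarrow> nat" where "strict_mono_on {3, 2, 1} f" "subseq [f 3, f 2, f 1] \<alpha>"
    unfolding contains_pattern_iff_map by auto
  moreover from this(1) have "f 2 < f 3" "f 1 < f 2"
    by (auto intro: strict_mono_onD)
  ultimately show "\<exists>a b c. b < a \<and> c < b \<and> subseq [a, b, c] \<alpha>" by blast
next
  assume "\<exists>a b c. b < a \<and> c < b \<and> subseq [a, b, c] \<alpha>"
  then obtain a b c where "b < a" "c < b" "subseq [a, b, c] \<alpha>" by blast
  moreover define f where "f v = (if v = 3 then a else if v = 2 then b else c)" for v :: nat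
  ultimately have "strict_mono_on (set [3, 2, 1]) f \<and> subseq (map f [3, 2, 1]) \<alpha>"
    by (auto simp: strict_mono_on_def)
  then show "contains_pattern \<alpha> [3, 2, 1]"
    unfolding contains_pattern_iff_map by blast
qed

text \<open>The second pattern for \<open>k = d + e + 1\<close>: \<open>e\<close> letters stand
  before \<open>1\<close> and \<open>d - 1\<close> behind the largest letter.\<close>

definition grid :: "nat \<Rightarrow> nat \<Rightarrow> nat list" where
  "grid d e = [d + 1..<d + e + 1] @ [1, d + e + 1] @ [2..<d + 1]"

lemma set_grid: "1 \<le> d \<Longrightarrow> set (grid d e) = {1..d + e + 1}"
  by (auto simp: grid_def)

lemma map_nth_upt:
  "map (\<lambda>v. (p @ xs @ q) ! (v - 1)) [Suc (length p)..<Suc (length p + length xs)] = xs"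
proof (rule nth_equalityI)
  fix i assume "i < length (map (\<lambda>v. (p @ xs @ q) ! (v - 1)) [Suc (length p)..<Suc (length p + length xs)])"
  then have "i < length xs" unfolding length_map length_upt by linarith
  then show "map (\<lambda>v. (p @ xs @ q) ! (v - 1)) [Suc (length p)..<Suc (length p + length xs)] ! i = xs ! i"
    by (simp add: nth_append del: upt_Suc)
qed (simp del: upt_Suc)

text \<open>The same occurrence is listed by value in \<open>y # xs @ bs @ [z]\<close> and by
  position in \<open>bs @ [y, z] @ xs\<close>; the relabelling sends the letter v to the v-th entry
  of the former.\<close>

lemma contains_grid_iff:
  assumes "1 \<le> d"
  shows "contains_pattern \<alpha> (grid d e) \<longleftrightarrow>
    (\<exists>bs y z xs. length bs = e \<and> length xs = d - 1 \<and> sorted_wrt (<) (y # xs @ bs @ [z]) \<and>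
       subseq (bs @ [y, z] @ xs) \<alpha>)" (is "_ \<longleftrightarrow> ?R")
proof
  assume "contains_pattern \<alpha> (grid d e)"
  then obtain f where f: "strict_mono_on {1..d + e + 1} f" "subseq (map f (grid d e)) \<alpha>"
    by (auto simp: contains_pattern_iff_map set_grid[OF assms])
  have "[1] @ [2..<d + 1] @ [d + 1..<d + e + 1] @ [d + e + 1] = [1..<d + e + 2]"
    using assms upt_add_eq_append[of 2 "d + 1" e] upt_conv_Cons[of 1 "d + e + 2"]
    by (simp add: numeral_2_eq_2)
  moreover have "sorted_wrt (<) (map f [1..<d + e + 2])"
    unfolding sorted_wrt_map
    by (rule sorted_wrt_mono_rel[OF _ sorted_wrt_upt]) (use f(1) in \<open>auto intro: strict_mono_onD\<close>)
  ultimately have "sorted_wrt (<) (map f ([1] @ [2..<d + 1] @ [d + 1..<d + e + 1] @ [d + e + 1]))"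
    by metis
  then have "sorted_wrt (<) (f 1 # map f [2..<d + 1] @ map f [d + 1..<d + e + 1] @ [f (d + e + 1)])"
    by simp
  moreover have "subseq (map f [d + 1..<d + e + 1] @ [f 1, f (d + e + 1)] @ map f [2..<d + 1]) \<alpha>"
    using f(2) by (simp add: grid_def)
  moreover have "length (map f [d + 1..<d + e + 1]) = e" "length (map f [2..<d + 1]) = d - 1"
    by (simp_all del: upt_Suc)
  ultimately show ?R by blast
next
  assume ?R
  then obtain bs y z xs where len: "length bs = e" "length xs = d - 1"
    and s: "sorted_wrt (<) (y # xs @ bs @ [z])" and sub: "subseq (bs @ [y, z] @ xs) \<alpha>"
    by blast
  define f where "f = (\<lambda>v. (y # xs @ bs @ [z]) ! (v - 1))"
  have "strict_mono_on (set (grid d e)) f"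
  proof (rule strict_mono_onI)
    fix r t assume "r \<in> set (grid d e)" "t \<in> set (grid d e)" "r < t"
    then have "r - 1 < t - 1" "t - 1 < length (y # xs @ bs @ [z])"
      using len assms by (auto simp: set_grid)
    then show "f r < f t"
      unfolding f_def by (rule sorted_wrt_nth_less[OF s])
  qed
  moreover have "map f [d + 1..<d + e + 1] = bs"
    using map_nth_upt[of "y # xs" bs "[z]"] len assms by (simp add: f_def del: upt_Suc)
  moreover have "map f [2..<d + 1] = xs"
  proof -
    have "[2..<d + 1] = [Suc (length [y])..<Suc (length [y] + length xs)]"
      using len assms by (intro arg_cong2[where f = upt]) simp_all
    then show ?thesis
      using map_nth_upt[of "[y]" xs "bs @ [z]"] unfolding f_def by (simp only: append_Cons append_Nil)
  qed
  moreover have "f 1 = y" by (simp add: f_def)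
  moreover have "f (d + e + 1) = z"
  proof -
    have "d + e + 1 - 1 = length (y # xs @ bs)" using len assms by simp
    then show ?thesis
      unfolding f_def using nth_append_length[of "y # xs @ bs" z "[]"] by simp
  qed
  ultimately have "strict_mono_on (set (grid d e)) f" "map f (grid d e) = bs @ [y, z] @ xs"
    unfolding grid_def map_append list.map by simp_all
  then show "contains_pattern \<alpha> (grid d e)"
    unfolding contains_pattern_iff_map using sub by metis
qed

section \<open>Occurrences that use an inserted maximum\<close>

lemma subseq_middle:
  assumes "subseq (p @ N # q) (u @ N # v)" and "N \<notin> set u" "N \<notin> set v"
  shows "subseq p u \<and> subseq q v"
  using assms
proof (induction u arbitrary: p)
  case Nil
  show ?case
  proof (cases p)
    case (Cons a p')
    have "N \<in> set v"
    proof (cases "a = N")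
      case True
      then have "subseq (p' @ N # q) v" using Nil Cons by simp
      then show ?thesis by (auto dest!: list_emb_appendD list_emb_ConsD)
    next
      case False
      then have "subseq (p @ N # q) v" using Nil Cons by simp
      then show ?thesis by (auto dest!: list_emb_appendD list_emb_ConsD)
    qed
    then show ?thesis using Nil by simp
  qed (use Nil in simp)
next
  case (Cons x u)
  show ?case
  proof (cases "p \<noteq> [] \<and> hd p = x")
    case True
    then obtain p' where "p = x # p'" by (cases p) auto
    then show ?thesis using Cons.prems Cons.IH[of p'] by simp
  next
    case False
    then have "subseq (p @ N # q) (u @ N # v)"
      using Cons.prems by (cases p) (auto split: if_splits)
    then have "subseq p u \<and> subseq q v" using Cons.prems Cons.IH[of p] by simp
    then show ?thesis by (simp add: list_emb_Cons)
  qed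
qed

lemma subseq_avoid_middle:
  assumes "subseq xs (u @ N # v)" "N \<notin> set xs"
  shows "subseq xs (u @ v)"
proof -
  have "subseq (filter (\<lambda>x. x \<noteq> N) xs) (filter (\<lambda>x. x \<noteq> N) (u @ N # v))"
    using assms(1) by (rule subseq_filter)
  moreover have "filter (\<lambda>x. x \<noteq> N) xs = xs" using assms(2) by (auto simp: filter_id_conv)
  moreover have "subseq (filter (\<lambda>x. x \<noteq> N) (u @ N # v)) (u @ v)" by simp (metis filter_append subseq_filter_left)
  ultimately show ?thesis by (metis subseq_order.order_trans)
qed

lemma subseq_insert_middle: "subseq (u @ v) (u @ N # v)"
  by (rule list_emb_append_mono) auto

lemma set_subseq: "subseq xs ys \<Longrightarrow> set xs \<subseteq> set ys"
  by (auto elim: list_emb_set)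

lemma sorted_iff_no_inversion:
  "sorted v \<longleftrightarrow> \<not> (\<exists>b c. c < b \<and> subseq [b, c] v)"
proof (induction v)
  case (Cons x v)
  have "subseq [b, c] (x # v) \<longleftrightarrow> b = x \<and> c \<in> set v \<or> subseq [b, c] v" for b c
    by (auto simp: subseq_singleton_left dest: subseq_Cons' list_emb_ConsD)
  then show ?case using Cons by (auto simp: not_less)
qed simp

definition has_321 :: "nat list \<Rightarrow> bool" where
  "has_321 \<alpha> \<longleftrightarrow> (\<exists>a b c. b < a \<and> c < b \<and> subseq [a, b, c] \<alpha>)"

definition has_grid :: "nat \<Rightarrow> nat \<Rightarrow> nat list \<Rightarrow> bool" where
  "has_grid d e \<alpha> \<longleftrightarrow>
    (\<exists>bs y z xs. length bs = e \<and> length xs = d - 1 \<and> sorted_wrt (<) (y # xs @ bs @ [z]) \<and>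
       subseq (bs @ [y, z] @ xs) \<alpha>)"

text \<open>The pattern \<open>grid d e\<close> with its largest entry removed and its gap between \<open>u\<close> and \<open>v\<close>.\<close>

definition grid_around :: "nat \<Rightarrow> nat \<Rightarrow> nat list \<Rightarrow> nat list \<Rightarrow> bool" where
  "grid_around d e u v \<longleftrightarrow>
    (\<exists>bs y xs. length bs = e \<and> length xs = d - 1 \<and> sorted_wrt (<) (y # xs @ bs) \<and>
       subseq (bs @ [y]) u \<and> subseq xs v)"

lemma has_321_mono: "has_321 \<alpha> \<Longrightarrow> subseq \<alpha> \<beta> \<Longrightarrow> has_321 \<beta>"
  unfolding has_321_def using subseq_order.order_trans by blast

lemma has_grid_mono: "has_grid d e \<alpha> \<Longrightarrow> subseq \<alpha> \<beta> \<Longrightarrow> has_grid d e \<beta>"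
  unfolding has_grid_def using subseq_order.order_trans by blast

text \<open>A new maximum can only play the letter 3, and then the other two letters are an
  inversion behind it.\<close>

lemma has_321_insert_max:
  assumes "\<forall>x\<in>set (u @ v). x < N"
  shows "has_321 (u @ N # v) \<longleftrightarrow> has_321 (u @ v) \<or> \<not> sorted v"
proof
  assume "has_321 (u @ N # v)"
  then obtain a b c where abc: "b < a" "c < b" "subseq [a, b, c] (u @ N # v)"
    by (auto simp: has_321_def)
  have "a \<le> N" using set_subseq[OF abc(3)] assms by (auto intro: less_imp_le)
  show "has_321 (u @ v) \<or> \<not> sorted v"
  proof (cases "a = N")
    case True
    then have "subseq [b, c] v"
      using subseq_middle[of "[]" N "[b, c]" u v] abc assms by auto
    then show ?thesis using abc by (auto simp: sorted_iff_no_inversion)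
  next
    case False
    with abc(1,2) \<open>a \<le> N\<close> have "N \<notin> set [a, b, c]" by auto
    with abc(3) have "subseq [a, b, c] (u @ v)" by (rule subseq_avoid_middle)
    then show ?thesis using abc by (auto simp: has_321_def)
  qed
next
  assume "has_321 (u @ v) \<or> \<not> sorted v"
  then show "has_321 (u @ N # v)"
  proof
    assume "\<not> sorted v"
    then obtain b c where bc: "c < b" "subseq [b, c] v" by (auto simp: sorted_iff_no_inversion)
    then have "b \<in> set v" using set_subseq by fastforce
    moreover have "subseq (N # [b, c]) (u @ N # v)"
      using bc(2) by (intro list_emb_append2 subseq_Cons2)
    ultimately show ?thesis using bc(1) assms by (auto simp: has_321_def)
  qed (rule has_321_mono[OF _ subseq_insert_middle])
qed

text \<open>Every letter but the largest has \<open>z\<close> above it, so a new maximum can only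
  play \<open>z\<close>; the occurrence then splits at it.\<close>

lemma has_grid_insert_max:
  assumes "\<forall>x\<in>set (u @ v). x < N"
  shows "has_grid d e (u @ N # v) \<longleftrightarrow> has_grid d e (u @ v) \<or> grid_around d e u v"
proof
  assume "has_grid d e (u @ N # v)"
  then obtain bs y z xs where len: "length bs = e" "length xs = d - 1"
    and s: "sorted_wrt (<) (y # xs @ bs @ [z])" and sub: "subseq (bs @ [y, z] @ xs) (u @ N # v)"
    by (auto simp: has_grid_def)
  have lt: "\<forall>x\<in>set (y # xs @ bs). x < z" using s by (auto simp: sorted_wrt_append)
  have "z \<le> N" using set_subseq[OF sub] assms by (auto intro: less_imp_le)
  show "has_grid d e (u @ v) \<or> grid_around d e u v"
  proof (cases "z = N")
    case True
    then have "subseq (bs @ [y]) u \<and> subseq xs v"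
      using sub assms by (intro subseq_middle[of _ N]) auto
    moreover have "sorted_wrt (<) (y # xs @ bs)" using s by (auto simp: sorted_wrt_append)
    ultimately show ?thesis
      using len unfolding grid_around_def by blast
  next
    case False
    with lt \<open>z \<le> N\<close> have "N \<notin> set (bs @ [y, z] @ xs)"
      by (auto simp: not_le[symmetric])
    then have "subseq (bs @ [y, z] @ xs) (u @ v)" using sub by (rule subseq_avoid_middle[rotated])
    then show ?thesis using len s unfolding has_grid_def by blast
  qed
next
  assume "has_grid d e (u @ v) \<or> grid_around d e u v"
  then show "has_grid d e (u @ N # v)"
  proof
    assume "grid_around d e u v"
    then obtain bs y xs where *: "length bs = e" "length xs = d - 1" "sorted_wrt (<) (y # xs @ bs)"
      "subseq (bs @ [y]) u" "subseq xs v"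
      by (auto simp: grid_around_def)
    have "\<forall>x\<in>set (y # xs @ bs). x < N"
      using set_subseq[OF *(4)] set_subseq[OF *(5)] assms by auto
    then have "sorted_wrt (<) (y # xs @ bs @ [N])" using *(3) by (auto simp: sorted_wrt_append)
    moreover have "subseq ((bs @ [y]) @ (N # xs)) (u @ N # v)"
      using *(4,5) by (intro list_emb_append_mono) auto
    ultimately show ?thesis
      unfolding has_grid_def using *(1,2)
      by (intro exI[of _ bs] exI[of _ y] exI[of _ N] exI[of _ xs]) simp
  qed (rule has_grid_mono[OF _ subseq_insert_middle])
qed

section \<open>The maximal increasing suffix and the state\<close>

fun inc_suffix :: "nat list \<Rightarrow> nat list" where
  "inc_suffix [] = []"
| "inc_suffix (x # xs) = (if sorted (x # xs) then x # xs else inc_suffix xs)"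

lemma inc_suffix_sorted: "sorted v \<Longrightarrow> inc_suffix v = v"
  by (cases v) auto

text \<open>The descent from \<open>last u\<close> to \<open>hd w\<close> stops the suffix from
  growing. This condition is the working description of the decomposition from here on.\<close>

lemma inc_suffix_eq:
  assumes "u = [] \<or> w \<noteq> [] \<and> hd w < last u" "sorted w"
  shows "inc_suffix (u @ w) = w"
  using assms
proof (induction u)
  case (Cons x u)
  have "\<not> sorted ((x # u) @ w)"
  proof
    assume "sorted ((x # u) @ w)"
    then have "last (x # u) \<le> hd w"
      using Cons.prems(1) unfolding sorted_append by (metis hd_in_set last_in_set list.distinct(1))
    then show False using Cons.prems(1) by auto
  qed
  moreover have "inc_suffix (u @ w) = w"
    using Cons by (cases "u = []") (auto simp: inc_suffix_sorted)
  ultimately show ?case by simp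
qed (simp add: inc_suffix_sorted)

lemma inc_suffix_decomp:
  obtains u where "\<alpha> = u @ inc_suffix \<alpha>" "sorted (inc_suffix \<alpha>)"
    "u = [] \<or> inc_suffix \<alpha> \<noteq> [] \<and> hd (inc_suffix \<alpha>) < last u"
proof (induction \<alpha> arbitrary: thesis)
  case Nil
  then show ?case by simp
next
  case (Cons x xs)
  show ?case
  proof (cases "sorted (x # xs)")
    case True
    then show ?thesis using Cons.prems[of "[]"] by simp
  next
    case False
    obtain u where u: "xs = u @ inc_suffix xs" "sorted (inc_suffix xs)"
      "u = [] \<or> inc_suffix xs \<noteq> [] \<and> hd (inc_suffix xs) < last u"
      using Cons.IH by blast
    have "inc_suffix xs \<noteq> [] \<and> hd (inc_suffix xs) < last (x # u)"
    proof (cases "u = []")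
      case True
      then have xs: "inc_suffix xs = xs" "sorted xs" using u by auto
      with False have "xs \<noteq> []" "hd xs < x"
        by (cases xs; auto)+
      then show ?thesis using True xs by simp
    qed (use u in auto)
    moreover have "inc_suffix (x # xs) = inc_suffix xs" using False by auto
    ultimately show ?thesis
      using Cons.prems[of "x # u"] u(1,2) by (metis append_Cons)
  qed
qed

lemma length_sorted_suffix_le: "sorted v \<Longrightarrow> length v \<le> length (inc_suffix (u @ v))"
  by (induction u) (auto simp: inc_suffix_sorted)

definition larger_before :: "nat list \<Rightarrow> nat \<Rightarrow> nat" where
  "larger_before u x = length (filter (\<lambda>y. x < y) u)"

text \<open>Searching only the part before the suffix is enough, since earlier suffix entries are
  not larger.\<close>

definition state :: "nat list \<Rightarrow> nat list" where
  "state \<alpha> = map (larger_before (take (length \<alpha> - length (inc_suffix \<alpha>)) \<alpha>)) (inc_suffix \<alpha>)"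

lemma state_eq:
  assumes "u = [] \<or> w \<noteq> [] \<and> hd w < last u" "sorted w"
  shows "state (u @ w) = map (larger_before u) w"
  using inc_suffix_eq[OF assms] by (simp add: state_def)

context
  fixes d e :: nat and u w :: "nat list"
  assumes d: "2 \<le> d" and e: "1 \<le> e"
    and decomp: "u = [] \<or> w \<noteq> [] \<and> hd w < last u" "sorted w"
    and dist: "distinct (u @ w)"
    and no_321: "\<not> has_321 (u @ w)" and no_grid: "\<not> has_grid d e (u @ w)"
begin

text \<open>
  The entry \<open>last u\<close> could replace a new maximum inserted right behind it, so this
  site creates no new occurrence.
\<close>

lemma not_grid_around_top: "\<not> grid_around d e u w"
proof
  assume "grid_around d e u w"
  then obtain bs y xs where *: "length bs = e" "length xs = d - 1" "sorted_wrt (<) (y # xs @ bs)"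
      "subseq (bs @ [y]) u" "subseq xs w"
    by (auto simp: grid_around_def)
  have "u \<noteq> []" using *(4) by auto
  then have w: "w \<noteq> []" "hd w < last u" using decomp by auto
  define L where "L = last u"
  obtain u0 where u: "u = u0 @ [L]" using \<open>u \<noteq> []\<close> unfolding L_def by (metis append_butlast_last_id)
  define b where "b = last bs"
  have bs: "bs \<noteq> []" using *(1) e by auto
  then have b: "b \<in> set bs" by (simp add: b_def)
  have bsu: "subseq bs u0"
  proof -
    from *(4) obtain us vs where "u = us @ vs" "subseq bs us" "subseq [y] vs"
      by (auto dest: list_emb_appendD)
    then have "vs \<noteq> []" by auto
    then have "u0 = us @ butlast vs" using u \<open>u = us @ vs\<close> by (metis butlast_append butlast_snoc)
    then show ?thesis using \<open>subseq bs us\<close> by (simp add: subseq_rev_drop_many)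
  qed
  have "b \<in> set u0" using set_subseq[OF bsu] b by auto
  then have "b \<noteq> L" using dist u by auto
  \<comment> \<open>Otherwise \<open>b\<close>, \<open>L\<close>, \<open>hd w\<close> would form a
    321.\<close>
  have inv: False if "L < b"
  proof -
    have "subseq ([b] @ [L] @ [hd w]) (u0 @ [L] @ w)"
      using \<open>b \<in> set u0\<close> w(1) by (intro list_emb_append_mono) (auto simp: subseq_singleton_left)
    moreover have "hd w < L" using w(2) by (simp add: L_def)
    ultimately have "has_321 (u @ w)"
      unfolding has_321_def u using that by auto
    then show False using no_321 by simp
  qed
  have "y < b" using *(3) b by auto
  show False
  \<comment> \<open>Either \<open>y\<close> lies before \<open>L\<close>, and \<open>L\<close>
    itself plays the largest letter, or \<open>y\<close> is \<open>L\<close>, so that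
    \<open>L < b\<close>.\<close>
  proof (cases "subseq (bs @ [y]) u0")
    case True
    have "b < L" using inv \<open>b \<noteq> L\<close> by force
    moreover have "x \<le> b" if "x \<in> set bs" for x
      using *(3) that bs unfolding b_def
      by (cases bs rule: rev_cases) (auto simp: sorted_wrt_append)
    moreover have "x < b" if "x \<in> set xs" for x
      using *(3) b that by (auto simp: sorted_wrt_append)
    ultimately have "\<forall>x\<in>set (y # xs @ bs). x < L"
      using \<open>y < b\<close> by (auto intro: less_trans le_less_trans)
    then have "sorted_wrt (<) (y # xs @ bs @ [L])"
      using *(3) by (auto simp: sorted_wrt_append)
    moreover have "subseq ((bs @ [y]) @ [L] @ xs) (u0 @ [L] @ w)"
      using True *(5) by (intro list_emb_append_mono) auto
    ultimately have "has_grid d e (u @ w)"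
      unfolding has_grid_def using *(1,2) u by auto
    then show False using no_grid by simp
  next
    case False
    obtain us vs where uv: "bs @ [y] = us @ vs" "subseq us u0" "subseq vs [L]"
      using *(4) unfolding u subseq_append_iff by blast
    with False have "vs \<noteq> []" by auto
    then have "last vs = y" using uv(1) by (metis last_appendR last_snoc)
    moreover have "last vs \<in> {L}" using set_subseq[OF uv(3)] last_in_set[OF \<open>vs \<noteq> []\<close>] by auto
    ultimately show False using inv \<open>y < b\<close> by simp
  qed
qed

lemma strict_sorted_w: "sorted_wrt (<) w"
  using decomp(2) dist by (simp add: strict_sorted_iff)

text \<open>For \<open>0 < t\<close> the entry \<open>hd w\<close> stands before the site and below
  everything behind it, so it can always serve as \<open>y\<close>. What remains is to find
  \<open>d - 1\<close> entries behind the site with \<open>e\<close> larger ones before them; these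
  lie in \<open>u\<close>, because \<open>take t w\<close> is smaller.\<close>

lemma grid_around_iff:
  assumes "0 < t" "t \<le> length w"
  shows "grid_around d e (u @ take t w) (drop t w) \<longleftrightarrow>
    d - 1 \<le> length (filter (\<lambda>c. e \<le> c) (map (larger_before u) (drop t w)))"
proof -
  have lt: "x < y" if "x \<in> set (take t w)" "y \<in> set (drop t w)" for x y
    using strict_sorted_w that by (metis append_take_drop_id sorted_wrt_append)
  have dw: "sorted_wrt (<) (drop t w)" using strict_sorted_w by (rule sorted_wrt_drop)
  have filt: "length (filter (\<lambda>c. e \<le> c) (map (larger_before u) xs)) =
      length (filter (\<lambda>x. e \<le> larger_before u x) xs)" for xs
    by (simp add: filter_map comp_def)
  show ?thesis
  proof
    assume "grid_around d e (u @ take t w) (drop t w)"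
    then obtain bs y xs where *: "length bs = e" "length xs = d - 1" "sorted_wrt (<) (y # xs @ bs)"
        "subseq (bs @ [y]) (u @ take t w)" "subseq xs (drop t w)"
      by (auto simp: grid_around_def)
    have "e \<le> larger_before u x" if "x \<in> set xs" for x
    proof -
      have "x \<in> set (drop t w)" using set_subseq[OF *(5)] that by auto
      then have 1: "filter (\<lambda>y. x < y) (u @ take t w) = filter (\<lambda>y. x < y) u"
        using lt by (force simp: filter_empty_conv)
      have "subseq bs (u @ take t w)" using *(4) by (metis subseq_order.order_trans subseq_rev_drop_many subseq_order.order_refl)
      then have "subseq (filter (\<lambda>y. x < y) bs) (filter (\<lambda>y. x < y) (u @ take t w))" by (rule subseq_filter)
      moreover have "filter (\<lambda>y. x < y) bs = bs"
        using *(3) that by (auto simp: filter_id_conv sorted_wrt_append)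
      ultimately show ?thesis
        unfolding larger_before_def 1 using *(1) by (metis list_emb_length)
    qed
    then have "filter (\<lambda>x. e \<le> larger_before u x) xs = xs" by (simp add: filter_id_conv)
    then have "subseq xs (filter (\<lambda>x. e \<le> larger_before u x) (drop t w))"
      using subseq_filter[OF *(5), of "\<lambda>x. e \<le> larger_before u x"] by simp
    then show "d - 1 \<le> length (filter (\<lambda>c. e \<le> c) (map (larger_before u) (drop t w)))"
      unfolding filt using *(2) by (metis list_emb_length)
  next
    assume ge: "d - 1 \<le> length (filter (\<lambda>c. e \<le> c) (map (larger_before u) (drop t w)))"
    define xs where "xs = take (d - 1) (filter (\<lambda>x. e \<le> larger_before u x) (drop t w))"
    have len: "length xs = d - 1" using ge unfolding filt by (simp add: xs_def)
    have subx: "subseq xs (drop t w)"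
      unfolding xs_def by (meson prefix_imp_subseq subseq_filter_left subseq_order.order_trans take_is_prefix)
    have sx: "sorted_wrt (<) xs"
      unfolding xs_def by (intro sorted_wrt_take sorted_wrt_filter dw)
    have "xs \<noteq> []" using len d by auto
    \<comment> \<open>Entries above the largest element of \<open>xs\<close> exceed all of
      \<open>xs\<close>, so one choice of \<open>bs\<close> serves them all.\<close>
    define x where "x = last xs"
    have x: "x \<in> set xs" "\<And>x'. x' \<in> set xs \<Longrightarrow> x' \<le> x"
      using \<open>xs \<noteq> []\<close> sx unfolding x_def
      by (cases xs rule: rev_cases; auto simp: sorted_wrt_append)+
    have "e \<le> larger_before u x" using x(1) by (auto simp: xs_def dest: in_set_takeD)
    define bs where "bs = take e (filter (\<lambda>y. x < y) u)"
    have lenb: "length bs = e" using \<open>e \<le> larger_before u x\<close> by (simp add: bs_def larger_before_def)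
    have subb: "subseq bs u"
      unfolding bs_def by (meson prefix_imp_subseq subseq_filter_left subseq_order.order_trans take_is_prefix)
    have xb: "x < b" if "b \<in> set bs" for b using that by (auto simp: bs_def dest: in_set_takeD)
    have xw: "x \<in> set (drop t w)" using set_subseq[OF subx] x(1) by auto
    \<comment> \<open>A descent among larger entries, followed by \<open>x\<close>, would be a
      321.\<close>
    have "sorted bs"
    proof (rule ccontr)
      assume "\<not> sorted bs"
      then obtain b c where bc: "c < b" "subseq [b, c] bs" by (auto simp: sorted_iff_no_inversion)
      then have "c \<in> set bs" using set_subseq by fastforce
      moreover have "subseq ([b, c] @ [x]) (u @ w)"
        using bc(2) subb xw
        by (intro list_emb_append_mono) (auto simp: subseq_singleton_left dest: in_set_dropD intro: subseq_order.order_trans)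
      ultimately show False using no_321 bc(1) xb by (auto simp: has_321_def)
    qed
    moreover have "distinct bs" using dist by (simp add: bs_def)
    ultimately have sb: "sorted_wrt (<) bs" by (simp add: strict_sorted_iff)
    have "w \<noteq> []" using assms by auto
    then have hd: "hd w \<in> set (take t w)" using assms(1) by (cases w; cases t) auto
    have "hd w < x'" if "x' \<in> set xs" for x'
      using lt[OF hd] set_subseq[OF subx] that by auto
    moreover have "x' < b" if "x' \<in> set xs" "b \<in> set bs" for x' b
      using x(2)[OF that(1)] xb[OF that(2)] by simp
    moreover have "hd w < b" if "b \<in> set bs" for b
      using lt[OF hd xw] xb[OF that] by simp
    ultimately have "sorted_wrt (<) (hd w # xs @ bs)"
      using sx sb by (auto simp: sorted_wrt_append)
    moreover have "subseq (bs @ [hd w]) (u @ take t w)"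
      using subb hd by (intro list_emb_append_mono) (auto simp: subseq_singleton_left)
    ultimately show "grid_around d e (u @ take t w) (drop t w)"
      unfolding grid_around_def using len lenb subx by blast
  qed
qed

lemma grid_around_iff_admissible:
  assumes "t \<le> length w"
  shows "\<not> grid_around d e (u @ take t w) (drop t w) \<longleftrightarrow> admissible_site d e (state (u @ w)) t"
proof (cases "t = 0")
  case True
  then show ?thesis using not_grid_around_top by (simp add: admissible_site_def)
next
  case False
  then show ?thesis
    using grid_around_iff[OF _ assms]
    by (simp add: admissible_site_def state_eq[OF decomp] drop_map not_le)
qed

end

text \<open>The new maximum creates a descent right before \<open>drop t w\<close>, which becomes
  the suffix. The entries \<open>take t w\<close> that leave the suffix are smaller, so only
  \<open>N\<close> raises the counts.\<close>

lemma state_insert: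
  assumes "u = [] \<or> w \<noteq> [] \<and> hd w < last u" "sorted w" "t < length w" "\<forall>x\<in>set (u @ w). x < N"
    "distinct w"
  shows "state (u @ take t w @ N # drop t w) = map Suc (drop t (state (u @ w)))"
proof -
  have "drop t w \<noteq> []" using assms(3) by simp
  then have "hd (drop t w) \<in> set w" by (meson hd_in_set in_set_dropD)
  then have "hd (drop t w) < N" using assms(4) by simp
  then have "state ((u @ take t w @ [N]) @ drop t w) = map (larger_before (u @ take t w @ [N])) (drop t w)"
    using assms(2) \<open>drop t w \<noteq> []\<close> by (intro state_eq) (auto simp: sorted_wrt_drop)
  moreover have "larger_before (u @ take t w @ [N]) x = Suc (larger_before u x)" if "x \<in> set (drop t w)" for x
  proof -
    have "sorted (take t w @ drop t w)" using assms(2) by simp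
    then have "\<forall>y\<in>set (take t w). \<not> x < y" using that unfolding sorted_append by (auto simp: not_less)
    moreover have "x < N" using that assms(4) by (auto dest: in_set_dropD)
    ultimately show ?thesis by (simp add: larger_before_def filter_empty_conv)
  qed
  ultimately show ?thesis
    by (simp add: state_eq[OF assms(1,2)] drop_map)
qed

lemma state_append_max:
  assumes "u = [] \<or> w \<noteq> [] \<and> hd w < last u" "sorted w" "\<forall>x\<in>set (u @ w). x < N"
  shows "state (u @ w @ [N]) = state (u @ w) @ [0]"
proof -
  have "state (u @ (w @ [N])) = map (larger_before u) (w @ [N])"
    using assms by (intro state_eq) (auto simp: sorted_append less_imp_le)
  moreover have "larger_before u N = 0"
    using assms(3) by (auto simp: larger_before_def filter_empty_conv not_less less_imp_le)
  ultimately show ?thesis by (simp add: state_eq[OF assms(1,2)])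
qed

section \<open>Counting avoiders through insertion sites\<close>

definition avoiders :: "nat \<Rightarrow> nat \<Rightarrow> nat \<Rightarrow> nat list set" where
  "avoiders d e n = {\<alpha> \<in> permutations_of_set {1..n}. \<not> has_321 \<alpha> \<and> \<not> has_grid d e \<alpha>}"

definition ins_max :: "nat list \<Rightarrow> nat \<Rightarrow> nat list" where
  "ins_max \<alpha> p = take p \<alpha> @ Suc (length \<alpha>) # drop p \<alpha>"

definition sites :: "nat \<Rightarrow> nat \<Rightarrow> nat list \<Rightarrow> nat set" where
  "sites d e \<alpha> = {p. p \<le> length \<alpha> \<and> sorted (drop p \<alpha>) \<and> \<not> grid_around d e (take p \<alpha>) (drop p \<alpha>)}"

lemma finite_avoiders: "finite (avoiders d e n)"
  by (simp add: avoiders_def)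

lemma avoidersD:
  assumes "\<alpha> \<in> avoiders d e n"
  shows "length \<alpha> = n" "distinct \<alpha>" "set \<alpha> = {1..n}" "\<not> has_321 \<alpha>" "\<not> has_grid d e \<alpha>"
  using assms by (auto simp: avoiders_def permutations_of_set_def distinct_card[symmetric])

text \<open>The inverse deletes the maximum; the two insertion criteria identify
  \<open>sites\<close> as the positions that keep both patterns out.\<close>

lemma bij_betw_ins_max:
  "bij_betw (\<lambda>(\<alpha>, p). ins_max \<alpha> p) (SIGMA \<alpha>:avoiders d e n. sites d e \<alpha>) (avoiders d e (Suc n))"
proof (rule bij_betw_imageI)
  show "inj_on (\<lambda>(\<alpha>, p). ins_max \<alpha> p) (SIGMA \<alpha>:avoiders d e n. sites d e \<alpha>)"
  proof (rule inj_onI, clarify)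
    fix \<alpha> p \<beta> q
    assume A: "\<alpha> \<in> avoiders d e n" "\<beta> \<in> avoiders d e n" "p \<in> sites d e \<alpha>" "q \<in> sites d e \<beta>"
      and eq: "ins_max \<alpha> p = ins_max \<beta> q"
    note a = avoidersD[OF A(1)] and b = avoidersD[OF A(2)]
    have "Suc n \<notin> set (take p \<alpha>)" "Suc n \<notin> set (take q \<beta>)" "Suc n \<notin> set (drop p \<alpha>)"
      using a(3) b(3) by (auto dest: in_set_takeD in_set_dropD)
    with eq have "take p \<alpha> = take q \<beta> \<and> drop p \<alpha> = drop q \<beta>"
      unfolding ins_max_def a(1) b(1) by (auto simp: append_Cons_eq_iff)
    moreover from this have "p = q" using A(3,4) a(1) b(1)
      by (metis (mono_tags, lifting) sites_def mem_Collect_eq length_take min_absorb2)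
    ultimately show "\<alpha> = \<beta> \<and> p = q" by (metis append_take_drop_id)
  qed
  show "(\<lambda>(\<alpha>, p). ins_max \<alpha> p) ` (SIGMA \<alpha>:avoiders d e n. sites d e \<alpha>) = avoiders d e (Suc n)"
  proof (intro equalityI subsetI)
    fix \<beta> assume "\<beta> \<in> (\<lambda>(\<alpha>, p). ins_max \<alpha> p) ` (SIGMA \<alpha>:avoiders d e n. sites d e \<alpha>)"
    then obtain \<alpha> p where A: "\<alpha> \<in> avoiders d e n" "p \<in> sites d e \<alpha>" and \<beta>: "\<beta> = ins_max \<alpha> p" by auto
    note a = avoidersD[OF A(1)]
    have lt: "\<forall>x\<in>set (take p \<alpha> @ drop p \<alpha>). x < Suc n" using a(3) by auto
    have "\<not> has_321 \<beta>" "\<not> has_grid d e \<beta>"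
      using A(2) a(4,5) unfolding \<beta> ins_max_def a(1) has_321_insert_max[OF lt] has_grid_insert_max[OF lt]
      by (auto simp: sites_def)
    moreover have "set \<alpha> = set (take p \<alpha>) \<union> set (drop p \<alpha>)"
      by (metis append_take_drop_id set_append)
    then have "set \<beta> = insert (Suc n) (set \<alpha>)"
      by (simp add: \<beta> ins_max_def a(1))
    then have "set \<beta> = {1..Suc n}" using a(3) by auto
    moreover have "length \<beta> = Suc n" by (simp add: \<beta> ins_max_def a(1))
    ultimately show "\<beta> \<in> avoiders d e (Suc n)"
      by (simp add: avoiders_def permutations_of_set_def card_distinct)
  next
    fix \<beta> assume B: "\<beta> \<in> avoiders d e (Suc n)"
    note b = avoidersD[OF B]
    have "Suc n \<in> set \<beta>" using b(3) by simp
    then obtain u v where uv: "\<beta> = u @ Suc n # v" by (meson split_list)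
    have set: "set (u @ v) = {1..n}"
    proof -
      have "insert (Suc n) (set (u @ v)) = {1..Suc n}" "Suc n \<notin> set (u @ v)" using b(2,3) uv by auto
      then show ?thesis by (metis atLeastAtMostSuc_conv insert_ident le_add1 plus_1_eq_Suc atLeastAtMost_iff not_less_eq_eq order_refl)
    qed
    then have lt: "\<forall>x\<in>set (u @ v). x < Suc n" by auto
    have "\<not> has_321 (u @ v)" "sorted v" "\<not> has_grid d e (u @ v)" "\<not> grid_around d e u v"
      using b(4,5) unfolding uv has_321_insert_max[OF lt] has_grid_insert_max[OF lt] by auto
    moreover have "distinct (u @ v)" using b(2) uv by auto
    ultimately have "u @ v \<in> avoiders d e n" "length u \<in> sites d e (u @ v)"
      using set by (auto simp: avoiders_def permutations_of_set_def sites_def)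
    moreover from avoidersD(1)[OF this(1)] have "ins_max (u @ v) (length u) = \<beta>"
      by (simp add: ins_max_def uv)
    ultimately show "\<beta> \<in> (\<lambda>(\<alpha>, p). ins_max \<alpha> p) ` (SIGMA \<alpha>:avoiders d e n. sites d e \<alpha>)"
      by force
  qed
qed

lemma sum_sites:
  assumes "2 \<le> d" "1 \<le> e" "\<alpha> \<in> avoiders d e n"
  shows "(\<Sum>p\<in>sites d e \<alpha>. num_ext d e j (state (ins_max \<alpha> p))) = num_ext d e (Suc j) (state \<alpha>)"
proof -
  note a = avoidersD[OF assms(3)]
  define w where "w = inc_suffix \<alpha>"
  obtain u where u: "\<alpha> = u @ w" "sorted w" "u = [] \<or> w \<noteq> [] \<and> hd w < last u"
    unfolding w_def by (rule inc_suffix_decomp)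
  let ?S = "state \<alpha>"
  have lenS: "length ?S = length w" by (simp add: state_def w_def)
  have adm: "\<not> grid_around d e (u @ take t w) (drop t w) \<longleftrightarrow> admissible_site d e ?S t"
    if "t \<le> length w" for t
    unfolding u(1) using a(2,4,5) u assms(1,2) that by (intro grid_around_iff_admissible) auto
  \<comment> \<open>Every sorted end piece lies within the maximal one, so positions are sites of
    the state shifted by \<open>length u\<close>.\<close>
  have sites: "sites d e \<alpha> = (\<lambda>t. length u + t) ` {t \<in> {..length w}. admissible_site d e ?S t}"
  proof (intro equalityI subsetI)
    fix p assume p: "p \<in> sites d e \<alpha>"
    then have "length (drop p \<alpha>) \<le> length w"
      using length_sorted_suffix_le[of "drop p \<alpha>" "take p \<alpha>"] by (simp add: sites_def w_def)
    then have "length u \<le> p" using p u(1) by (simp add: sites_def)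
    then obtain t where t: "p = length u + t" using le_Suc_ex by blast
    then have "t \<le> length w" using p u(1) by (simp add: sites_def)
    then show "p \<in> (\<lambda>t. length u + t) ` {t \<in> {..length w}. admissible_site d e ?S t}"
      using p adm t u(1) by (auto simp: sites_def)
  next
    fix p assume "p \<in> (\<lambda>t. length u + t) ` {t \<in> {..length w}. admissible_site d e ?S t}"
    then show "p \<in> sites d e \<alpha>"
      using adm u(1,2) by (fastforce simp: sites_def sorted_wrt_drop)
  qed
  have lt: "\<forall>x\<in>set (u @ w). x < Suc n" using a(3) u(1) by auto
  have len: "length u + length w = n" using a(1) u(1) by simp
  have "(\<Sum>p\<in>sites d e \<alpha>. num_ext d e j (state (ins_max \<alpha> p))) =
      (\<Sum>t\<in>{t \<in> {..length w}. admissible_site d e ?S t}. num_ext d e j (state (u @ take t w @ Suc n # drop t w)))"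
    unfolding sites by (subst sum.reindex) (auto simp: ins_max_def u(1) len intro!: sum.cong inj_onI)
  also have "\<dots> = (\<Sum>t\<le>length w. if admissible_site d e ?S t then num_ext d e j (state (u @ take t w @ Suc n # drop t w)) else 0)"
    by (rule sum.inter_filter) simp
  \<comment> \<open>The site \<open>t = length w\<close> is insertion at the end, admissible because
    \<open>0 < d - 1\<close>.\<close>
  also have "\<dots> = (\<Sum>t<length w. if admissible_site d e ?S t then num_ext d e j (state (u @ take t w @ Suc n # drop t w)) else 0)
      + num_ext d e j (state (u @ w @ [Suc n]))"
    using assms(1) by (simp add: lenS admissible_site_def flip: lessThan_Suc_atMost)
  also have "\<dots> = (\<Sum>t<length ?S. if admissible_site d e ?S t then num_ext d e j (map Suc (drop t ?S)) else 0)
      + num_ext d e j (?S @ [0])"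
    unfolding lenS using state_insert[OF u(3,2) _ lt] state_append_max[OF u(3,2) lt] u(1) a(2)
    by (intro arg_cong2[where f = "(+)"] sum.cong) auto
  finally show ?thesis by simp
qed

text \<open>Since \<open>num_ext\<close> is 1 at 0, the cardinality is a sum of
  \<open>num_ext\<close> values; \<open>step\<close> moves one insertion at a time into its argument
  until only the empty permutation is left.\<close>

lemma card_avoiders:
  assumes "2 \<le> d" "1 \<le> e"
  shows "card (avoiders d e n) = num_ext d e n []"
proof -
  have step: "(\<Sum>\<alpha>\<in>avoiders d e (Suc n). num_ext d e j (state \<alpha>)) = (\<Sum>\<alpha>\<in>avoiders d e n. num_ext d e (Suc j) (state \<alpha>))" for n j
  proof -
    have "finite (sites d e \<alpha>)" for \<alpha> by (simp add: sites_def)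
    then have "(\<Sum>\<alpha>\<in>avoiders d e n. \<Sum>p\<in>sites d e \<alpha>. num_ext d e j (state (ins_max \<alpha> p))) =
        (\<Sum>(\<alpha>, p)\<in>(SIGMA \<alpha>:avoiders d e n. sites d e \<alpha>). num_ext d e j (state (ins_max \<alpha> p)))"
      by (intro sum.Sigma finite_avoiders) auto
    also have "\<dots> = (\<Sum>\<beta>\<in>avoiders d e (Suc n). num_ext d e j (state \<beta>))"
      by (subst sum.reindex_bij_betw[OF bij_betw_ins_max, symmetric]) (simp add: case_prod_unfold)
    finally show ?thesis using sum_sites[OF assms] by simp
  qed
  have "(\<Sum>\<alpha>\<in>avoiders d e m. num_ext d e j (state \<alpha>)) = (\<Sum>\<alpha>\<in>avoiders d e 0. num_ext d e (m + j) (state \<alpha>))" for m j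
    by (induction m arbitrary: j) (simp_all add: step del: num_ext.simps)
  from this[where m = n and j = 0] have "card (avoiders d e n) = (\<Sum>\<alpha>\<in>avoiders d e 0. num_ext d e n (state \<alpha>))" by simp
  moreover have "avoiders d e 0 = {[]}"
    by (auto simp: avoiders_def has_321_def has_grid_def)
  ultimately show ?thesis by (simp add: state_def)
qed

lemma X3_eq: "X3 (d + e + 1) d = {[3, 2, 1], grid d e}"
  by (simp add: X3_def grid_def)

lemma x3_eq_num_ext:
  assumes "2 \<le> d" "1 \<le> e"
  shows "x3 (d + e + 1) d n = num_ext d e n []"
proof -
  have "1 \<le> d" using assms by simp
  then have "x3 (d + e + 1) d n = card (avoiders d e n)"
    unfolding x3_def X3_eq avoiders_def avoids_pattern_def has_321_def has_grid_def contains_321_iff[symmetric]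
      contains_grid_iff[OF \<open>1 \<le> d\<close>, symmetric] by simp
  then show ?thesis using card_avoiders[OF assms] by simp
qed

section \<open>Reverse-complement\<close>

definition rev_compl :: "nat \<Rightarrow> nat list \<Rightarrow> nat list" where
  "rev_compl n \<alpha> = rev (map (\<lambda>v. Suc n - v) \<alpha>)"

lemma subseq_revI: "subseq xs ys \<Longrightarrow> subseq (rev xs) (rev ys)"
  by (induction rule: list_emb.induct) (auto intro: list_emb_append_mono subseq_rev_drop_many)

lemma set_rev_compl: "set (rev_compl n \<alpha>) = (\<lambda>v. Suc n - v) ` set \<alpha>"
  by (simp add: rev_compl_def)

lemma rev_compl_rev_compl: "set \<alpha> \<subseteq> {1..n} \<Longrightarrow> rev_compl n (rev_compl n \<alpha>) = \<alpha>"
  by (auto simp: rev_compl_def rev_map intro!: map_idI)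

lemma contains_pattern_rev_compl:
  assumes "set \<alpha> \<subseteq> {1..n}" "set \<tau> \<subseteq> {1..k}" "contains_pattern \<alpha> \<tau>"
  shows "contains_pattern (rev_compl n \<alpha>) (rev_compl k \<tau>)"
proof -
  obtain f where f: "strict_mono_on (set \<tau>) f" "subseq (map f \<tau>) \<alpha>"
    using assms(3) by (auto simp: contains_pattern_iff_map)
  have fn: "f v \<le> n" if "v \<in> set \<tau>" for v
    using set_subseq[OF f(2)] assms(1) that by fastforce
  define g where "g v = Suc n - f (Suc k - v)" for v
  have "map g (rev_compl k \<tau>) = rev_compl n (map f \<tau>)"
    using assms(2) by (auto simp: rev_compl_def g_def simp flip: rev_map intro!: arg_cong[where f = f])
  moreover have "subseq (rev_compl n (map f \<tau>)) (rev_compl n \<alpha>)"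
    unfolding rev_compl_def by (intro subseq_revI subseq_map f(2))
  moreover have "strict_mono_on (set (rev_compl k \<tau>)) g"
  proof (rule strict_mono_onI)
    fix r s assume "r \<in> set (rev_compl k \<tau>)" "s \<in> set (rev_compl k \<tau>)" "r < s"
    then obtain v w where "r = Suc k - v" "s = Suc k - w" "v \<in> set \<tau>" "w \<in> set \<tau>"
      by (auto simp: set_rev_compl)
    moreover from this have "v \<le> k" "w \<le> k" using assms(2) by auto
    ultimately have vw: "v \<in> set \<tau>" "w \<in> set \<tau>" "w < v" "Suc k - r = v" "Suc k - s = w"
      using \<open>r < s\<close> by auto
    then have "f w < f v" using f(1) by (auto intro: strict_mono_onD)
    then show "g r < g s" using fn[OF vw(1)] by (simp add: g_def vw)
  qed
  ultimately show ?thesis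
    unfolding contains_pattern_iff_map by (intro exI[of _ g]) simp
qed

lemma rev_map_diff_upt: "b \<le> Suc m \<Longrightarrow> rev (map (\<lambda>v. m - v) [a..<b]) = [Suc m - b..<Suc m - a]"
  by (rule nth_equalityI) (auto simp: rev_nth simp del: upt_Suc)

text \<open>The \<open>e\<close> letters before \<open>1\<close> trade places with the
  \<open>d - 1\<close> letters behind the largest one.\<close>

lemma rev_compl_grid:
  assumes "1 \<le> d"
  shows "rev_compl (d + e + 1) (grid d e) = grid (e + 1) (d - 1)"
  unfolding rev_compl_def grid_def map_append rev_append list.map
  using assms by (simp add: rev_map_diff_upt add.commute del: upt_Suc)

text \<open>Reverse-complement fixes 321 and is injective. The inequality suffices for equality
  later, since sending (d, e) to (e + 1, d - 1) is an involution.\<close>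

lemma x3_le_rev_compl:
  assumes "2 \<le> d" "1 \<le> e"
  shows "x3 (d + e + 1) d n \<le> x3 (d + e + 1) (e + 1) n"
proof -
  define A where "A \<tau> = {\<alpha> \<in> permutations_of_set {1..n}. avoids_pattern \<alpha> [3, 2, 1] \<and> avoids_pattern \<alpha> \<tau>}" for \<tau>
  have [simp]: "rev_compl 3 [3, 2, Suc 0] = [3, 2, Suc 0]" by (simp add: rev_compl_def)
  have grid: "rev_compl (d + e + 1) (grid (e + 1) (d - 1)) = grid d e"
    using rev_compl_grid[of "e + 1" "d - 1"] assms by (simp add: add.commute)
  have "rev_compl n ` A (grid d e) \<subseteq> A (grid (e + 1) (d - 1))"
  proof
    fix \<beta> assume "\<beta> \<in> rev_compl n ` A (grid d e)"
    then obtain \<alpha> where "\<alpha> \<in> A (grid d e)" and \<beta>: "\<beta> = rev_compl n \<alpha>" by blast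
    then have \<alpha>: "set \<alpha> = {1..n}" "distinct \<alpha>"
      "avoids_pattern \<alpha> [3, 2, 1]" "avoids_pattern \<alpha> (grid d e)"
      by (simp_all add: A_def permutations_of_set_def)
    have inv: "rev_compl n \<beta> = \<alpha>" using \<alpha>(1) by (simp add: \<beta> rev_compl_rev_compl)
    have set: "set \<beta> = {1..n}"
    proof -
      have "(\<lambda>v. Suc n - v) ` {1..n} = {1..n}"
        by (rule bij_betw_imp_surj_on[OF bij_betw_byWitness[where f' = "\<lambda>v. Suc n - v"]]) auto
      then show ?thesis by (simp add: \<beta> \<alpha>(1) set_rev_compl)
    qed
    have "inj_on (\<lambda>v. Suc n - v) {1..n}" by (auto intro!: inj_onI)
    then have "distinct \<beta>"
      using \<alpha>(1,2) by (simp add: \<beta> rev_compl_def distinct_map)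
    moreover have "avoids_pattern \<beta> [3, 2, 1]"
      using contains_pattern_rev_compl[of \<beta> n "[3, 2, 1]" 3] set \<alpha>(3) inv
      by (auto simp: avoids_pattern_def)
    moreover have "avoids_pattern \<beta> (grid (e + 1) (d - 1))"
      unfolding avoids_pattern_def
    proof
      assume "contains_pattern \<beta> (grid (e + 1) (d - 1))"
      moreover have "set (grid (e + 1) (d - 1)) \<subseteq> {1..d + e + 1}"
        using assms by (subst set_grid) auto
      ultimately have "contains_pattern \<alpha> (grid d e)"
        using contains_pattern_rev_compl[of \<beta> n _ "d + e + 1"] set unfolding inv[symmetric] grid[symmetric] by blast
      then show False using \<alpha>(4) by (simp add: avoids_pattern_def)
    qed
    ultimately show "\<beta> \<in> A (grid (e + 1) (d - 1))"
      using set by (simp add: A_def permutations_of_set_def)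
  qed
  moreover have "inj_on (rev_compl n) (A (grid d e))"
    by (rule inj_on_inverseI[of _ "rev_compl n"]) (auto simp: A_def permutations_of_set_def intro: rev_compl_rev_compl)
  moreover have "finite (A \<tau>)" for \<tau> by (simp add: A_def)
  ultimately have "card (A (grid d e)) \<le> card (A (grid (e + 1) (d - 1)))"
    by (metis card_inj_on_le)
  moreover have "X3 (d + e + 1) (e + 1) = {[3, 2, 1], grid (e + 1) (d - 1)}"
    using X3_eq[of "e + 1" "d - 1"] assms by (simp add: add.commute)
  ultimately show ?thesis
    unfolding x3_def X3_eq by (simp add: A_def)
qed

lemma x3_rev_compl:
  assumes "2 \<le> d" "1 \<le> e"
  shows "x3 (d + e + 1) d n = x3 (d + e + 1) (e + 1) n"
  using x3_le_rev_compl[OF assms] x3_le_rev_compl[of "e + 1" "d - 1"] assms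
  by (intro antisym) (simp_all add: add.commute)

text \<open>
  Lowering \<open>d\<close> stops at \<open>2\<close>; reverse-complement then exchanges the roles of \<open>d\<close> and
  \<open>e + 1\<close>, so that lowering continues down to the pattern \<open>3142\<close>.
\<close>

lemma cheb_Q_ext_fps:
  assumes "2 \<le> d" "1 \<le> e"
  shows "cheb_Q (d + e + 1) * ext_fps d e = cheb_Q (d + e)"
proof -
  have "ext_fps 2 e = ext_fps (e + 1) 1"
  proof (rule fps_ext)
    fix n
    have "num_ext 2 e n [] = x3 (2 + e + 1) (e + 1) n"
      using x3_eq_num_ext[of 2 e n] x3_rev_compl[of 2 e n] assms by simp
    also have "\<dots> = num_ext (e + 1) 1 n []"
      using x3_eq_num_ext[of "e + 1" 1 n] assms by simp
    finally show "ext_fps 2 e $ n = ext_fps (e + 1) 1 $ n" by (simp add: ext_fps_def)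
  qed
  \<comment> \<open>At second parameter 1, \<open>e - 1\<close> steps raise the first one from 2 to
    \<open>e + 1\<close>; after the exchange, \<open>d - 2\<close> steps at the given
    \<open>e\<close> finish.\<close>
  moreover have "cheb_Q (Suc (3 + (e - 1))) * ext_fps (e - 1 + 2) 1 = cheb_Q (3 + (e - 1))"
    by (rule cheb_Q_ext_fps_shift) (use cheb_Q_ext_fps_2_1 in simp)
  ultimately have "cheb_Q (Suc (e + 2)) * ext_fps 2 e = cheb_Q (e + 2)"
    using assms(2) by (simp add: eval_nat_numeral)
  moreover have "Suc (e + 2 + (d - 2)) = d + e + 1" "d - 2 + 2 = d" "e + 2 + (d - 2) = d + e"
    using assms(1) by simp_all
  ultimately show ?thesis
    using cheb_Q_ext_fps_shift[of "e + 2" e "d - 2"] by metis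
qed

theorem theorem3p3:
  fixes k d :: nat
  assumes "k \<ge> 4" and "2 \<le> d" and "d \<le> k - 2"
  shows "(\<forall>n\<ge>k. (\<Sum>j=0..k. (-1) ^ j * int ((k - j) choose j) * int (x3 k d (n - j))) = 0)
    \<and> (\<forall>n\<le>k - 1. real (x3 k d n) = 1 / real (n + 1) * real ((2 * n) choose n))
    \<and> in_sqrt (Abs_fps (\<lambda>n. real (x3 k d n))) =
        cheb_U_fls (k - 1) (1 / (2 * fls_X)) / (fls_X * cheb_U_fls k (1 / (2 * fls_X)))"
proof -
  \<comment> \<open>The number of letters before \<open>1\<close>; it is positive because
    \<open>d \<le> k - 2\<close>.\<close>
  define e where "e = k - d - 1"
  have k: "k = d + e + 1" and e: "1 \<le> e" using assms by (simp_all add: e_def)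
  let ?F = "Abs_fps (\<lambda>n. real (x3 k d n))"
  have "?F = ext_fps d e"
    unfolding k ext_fps_def x3_eq_num_ext[OF assms(2) e] ..
  then have Q: "cheb_Q k * ?F = cheb_Q (k - 1)"
    using cheb_Q_ext_fps[OF assms(2) e] by (simp add: k)
  have "1 \<le> k" using assms(1) by simp
  have "real (x3 k d n) = catalan n" if "n \<le> k - 1" for n
    using cheb_Q_quotient_nth[of "k - 1" ?F n] Q that \<open>1 \<le> k\<close> by simp
  then show ?thesis
    using recurrence_of_cheb_Q[OF Q \<open>1 \<le> k\<close>] in_sqrt_quotient[OF Q \<open>1 \<le> k\<close>]
    by (simp add: catalan_def)
qed

end
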